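(* Let $E\subset\mathbb{R}^d$ be a non-empty compact set and let $m$ be an integer with $0\le m\le d$. Then $$\underline{\dim}_{qH}\, P_V E=\min\left\{m,\ \underline{\dim}_{qH}\,E\right\}\quad\text{for }\gamma_{d,m}\text{-almost all }V\in G(d,m),$$ and $$\overline{\dim}_{qH}\, P_V E=\min\left\{m,\ \overline{\dim}_{qH}\,E\right\}\quad\text{for }\gamma_{d,m}\text{-almost all }V\in G(d,m).$$
   Context: $G(d,m)$ is the Grassmannian of all $m$-dimensional linear subspaces of $\mathbb{R}^d$, $\gamma_{d,m}$ is the Haar (rotation-invariant probability) measure on $G(d,m)$, and $P_V$ is the orthogonal projection of $\mathbb{R}^d$ onto $V$. $|U|$ denotes the diameter of a set $U$. Intermediate dimensions. For a non-empty bounded set $F\subset\mathbb{R}^d$ and $\theta\in(0,1]$, the lower $\theta$-intermediate dimension $\underline{\dim}_\theta F$ is the infimum of all $s\ge 0$ such that for all $\epsilon>0$ and all $\delta_0>0$ there exist $0<\delta\le\delta_0$ and a cover $\{U_i\}_{i\in I}$ of $F$ with $\delta^{1/\theta}\le|U_i|\le\delta$ for all $i$ and $\sum_{i}|U_i|^s\le\epsilon$. The upper $\theta$-intermediate dimension $\overline{\dim}_\theta F$ is the infimum of all $s\ge 0$ such that for all $\epsilon>0$ there exists $\delta_0>0$ such that for all $0<\delta\le\delta_0$ there is a cover $\{U_i\}_{i\in I}$ of $F$ with $\delta^{1/\theta}\le|U_i|\le\delta$ for all $i$ and $\sum_i|U_i|^s\le\epsilon$. Quasi-Hausdorff dimensions.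 $\underline{\dim}_{qH}F:=\lim_{\theta\to0^+}\underline{\dim}_\theta F$ and $\overline{\dim}_{qH}F:=\lim_{\theta\to0^+}\overline{\dim}_\theta F$. *)

theory Defs
  imports "HOL-Probability.Probability"
begin

section \<open>Intermediate and quasi-Hausdorff dimensions\<close>

text \<open>
  A family of sets is represented by the set of its members: omitting repetitions only
  decreases the sum of the powers of the diameters. The index set is not assumed to be countable.
  Boundedness is required explicitly, because the library function \<^const>\<open>diameter\<close> has an
  unspecified value on unbounded sets.
\<close>

definition admissible_cover :: "real \<Rightarrow> real \<Rightarrow> 'a::metric_space set \<Rightarrow> 'a set set \<Rightarrow> bool" where
  "admissible_cover \<theta> \<delta> F \<U> \<longleftrightarrow>
     F \<subseteq> \<Union>\<U> \<and>
     (\<forall>U\<in>\<U>. bounded U \<and> \<delta> powr (1 / \<theta>) \<le> diameter U \<and> diameter U \<le> \<delta>)"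

definition diameter_sum :: "real \<Rightarrow> 'a::metric_space set set \<Rightarrow> ennreal" where
  "diameter_sum s \<U> = (\<Sum>\<^sub>\<infinity>U\<in>\<U>. ennreal (diameter U powr s))"

definition lower_intermediate_dim :: "real \<Rightarrow> 'a::metric_space set \<Rightarrow> real" where
  "lower_intermediate_dim \<theta> F =
     Inf {s. 0 \<le> s \<and>
       (\<forall>\<epsilon>>0. \<forall>\<delta>\<^sub>0>0. \<exists>\<delta>. 0 < \<delta> \<and> \<delta> \<le> \<delta>\<^sub>0 \<and>
          (\<exists>\<U>. admissible_cover \<theta> \<delta> F \<U> \<and> diameter_sum s \<U> \<le> ennreal \<epsilon>))}"

definition upper_intermediate_dim :: "real \<Rightarrow> 'a::metric_space set \<Rightarrow> real" where
  "upper_intermediate_dim \<theta> F =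
     Inf {s. 0 \<le> s \<and>
       (\<forall>\<epsilon>>0. \<exists>\<delta>\<^sub>0>0. \<forall>\<delta>. 0 < \<delta> \<and> \<delta> \<le> \<delta>\<^sub>0 \<longrightarrow>
          (\<exists>\<U>. admissible_cover \<theta> \<delta> F \<U> \<and> diameter_sum s \<U> \<le> ennreal \<epsilon>))}"

definition lower_quasi_Hausdorff_dim :: "'a::metric_space set \<Rightarrow> real" where
  "lower_quasi_Hausdorff_dim F = Lim (at_right 0) (\<lambda>\<theta>. lower_intermediate_dim \<theta> F)"

definition upper_quasi_Hausdorff_dim :: "'a::metric_space set \<Rightarrow> real" where
  "upper_quasi_Hausdorff_dim F = Lim (at_right 0) (\<lambda>\<theta>. upper_intermediate_dim \<theta> F)"


section \<open>Orthogonal projections and the Grassmannian\<close>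

definition orth_proj :: "'a::euclidean_space set \<Rightarrow> 'a \<Rightarrow> 'a" where
  "orth_proj V x = (THE y. y \<in> V \<and> (\<forall>w\<in>V. orthogonal (x - y) w))"

lemma orth_proj_unique:
  fixes V :: "'a::euclidean_space set"
  assumes V: "subspace V" and y: "y \<in> V" "\<And>w. w \<in> V \<Longrightarrow> orthogonal (x - y) w"
  shows "orth_proj V x = y"
  unfolding orth_proj_def
proof (rule the_equality)
  show "y \<in> V \<and> (\<forall>w\<in>V. orthogonal (x - y) w)" using y by blast
next
  fix z assume z: "z \<in> V \<and> (\<forall>w\<in>V. orthogonal (x - z) w)"
  have "z - y \<in> V" using z y V by (simp add: subspace_diff)
  then have "(x - y) \<bullet> (z - y) = 0" "(x - z) \<bullet> (z - y) = 0"
    using z y(2) by (auto simp: orthogonal_def)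
  then have "(z - y) \<bullet> (z - y) = 0"
    by (simp add: inner_diff_left)
  then show "z = y" by simp
qed

lemma orth_proj_props:
  fixes V :: "'a::euclidean_space set"
  assumes V: "subspace V"
  shows orth_proj_in: "orth_proj V x \<in> V"
    and orth_proj_orthogonal: "w \<in> V \<Longrightarrow> orthogonal (x - orth_proj V x) w"
proof -
  have sp: "span V = V" using V by simp
  obtain y z where yz: "y \<in> span V" "\<And>w. w \<in> span V \<Longrightarrow> orthogonal z w" "x = y + z"
    using orthogonal_subspace_decomp_exists[of V x] by blast
  have "orth_proj V x = y"
    using yz by (intro orth_proj_unique[OF V]) (auto simp: sp)
  then show "orth_proj V x \<in> V" "w \<in> V \<Longrightarrow> orthogonal (x - orth_proj V x) w"
    using yz by (auto simp: sp)
qed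

lemma orth_proj_ident:
  fixes V :: "'a::euclidean_space set"
  assumes "subspace V" "x \<in> V"
  shows "orth_proj V x = x"
  using assms by (intro orth_proj_unique) (auto simp: orthogonal_def)

lemma linear_orth_proj:
  fixes V :: "'a::euclidean_space set"
  assumes V: "subspace V"
  shows "linear (orth_proj V)"
proof (rule linearI)
  fix x y
  show "orth_proj V (x + y) = orth_proj V x + orth_proj V y"
  proof (rule orth_proj_unique[OF V])
    show "orth_proj V x + orth_proj V y \<in> V"
      using V by (simp add: orth_proj_in subspace_add)
    fix w assume "w \<in> V"
    then have "orthogonal (x - orth_proj V x) w" "orthogonal (y - orth_proj V y) w"
      using V by (auto intro: orth_proj_orthogonal)
    then show "orthogonal (x + y - (orth_proj V x + orth_proj V y)) w"
      by (simp add: orthogonal_def inner_diff_left inner_add_left)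
  qed
next
  fix c x
  show "orth_proj V (c *\<^sub>R x) = c *\<^sub>R orth_proj V x"
  proof (rule orth_proj_unique[OF V])
    show "c *\<^sub>R orth_proj V x \<in> V"
      using V by (simp add: orth_proj_in subspace_scale)
    fix w assume "w \<in> V"
    then have "orthogonal (x - orth_proj V x) w"
      using V by (auto intro: orth_proj_orthogonal)
    then show "orthogonal (c *\<^sub>R x - c *\<^sub>R orth_proj V x) w"
      by (simp add: orthogonal_def inner_diff_left)
  qed
qed

definition grassmannian :: "nat \<Rightarrow> (real ^ 'n) set set" where
  "grassmannian m = {V. subspace V \<and> dim V = m}"

text \<open>
  The usual metric on the Grassmannian, given by the operator norm of the difference of the
  projections. The value away from subspaces is irrelevant; it is fixed only because the locale
  \<^locale>\<open>Metric_space\<close> demands symmetry and nonnegativity everywhere.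
\<close>

definition grassmannian_dist :: "(real ^ 'n) set \<Rightarrow> (real ^ 'n) set \<Rightarrow> real" where
  "grassmannian_dist V W =
     (if subspace V \<and> subspace W then onorm (\<lambda>x. orth_proj V x - orth_proj W x) else 0)"

lemma Metric_space_grassmannian:
  "Metric_space (grassmannian m :: (real ^ 'n) set set) grassmannian_dist"
proof
  have bl: "bounded_linear (\<lambda>x. orth_proj V x - orth_proj W x)"
    if "subspace V" "subspace W" for V W :: "(real ^ 'n) set"
    using that by (intro bounded_linear_sub linear_conv_bounded_linear[THEN iffD1] linear_orth_proj)
  fix V W X :: "(real ^ 'n) set"
  show "0 \<le> grassmannian_dist V W"
    by (auto simp: grassmannian_dist_def intro!: onorm_pos_le bl)
  have "onorm (\<lambda>x. orth_proj V x - orth_proj W x) = onorm (\<lambda>x. orth_proj W x - orth_proj V x)"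
    by (simp add: onorm_def norm_minus_commute)
  then show "grassmannian_dist V W = grassmannian_dist W V"
    by (simp add: grassmannian_dist_def)
  assume "V \<in> grassmannian m" "W \<in> grassmannian m"
  then have sub: "subspace V" "subspace W" by (auto simp: grassmannian_def)
  show "grassmannian_dist V W = 0 \<longleftrightarrow> V = W"
  proof
    assume "grassmannian_dist V W = 0"
    then have eq: "orth_proj V x = orth_proj W x" for x
      using onorm_eq_0[OF bl[OF sub]] sub by (simp add: grassmannian_dist_def)
    show "V = W"
      by (metis eq orth_proj_ident orth_proj_in sub subsetI subset_antisym)
  qed (use sub in \<open>simp add: grassmannian_dist_def onorm_zero\<close>)
  assume "X \<in> grassmannian m"
  then have X: "subspace X" by (auto simp: grassmannian_def)
  show "grassmannian_dist V X \<le> grassmannian_dist V W + grassmannian_dist W X"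
    using onorm_triangle[OF bl[OF sub] bl[OF sub(2) X]] sub X
    by (simp add: grassmannian_dist_def)
qed

definition grassmannian_borel :: "nat \<Rightarrow> (real ^ 'n) set measure" where
  "grassmannian_borel m =
     sigma (grassmannian m)
       {A. openin (Metric_space.mtopology (grassmannian m) grassmannian_dist) A}"

text \<open>
  The measure \<open>\<gamma>\<close> on $G(d,m)$ is characterised by being the (unique) Borel probability measure
  invariant under all rotations $g \in SO(d)$; the rotation \<open>g\<close> maps a subspace \<open>V\<close> to \<open>g ` V\<close>,
  so that a set \<open>A\<close> of subspaces is mapped to \<open>(`) g ` A\<close>.
\<close>

definition grassmannian_haar :: "nat \<Rightarrow> (real ^ 'n) set measure \<Rightarrow> bool" where
  "grassmannian_haar m \<gamma> \<longleftrightarrow>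
     prob_space \<gamma> \<and>
     sets \<gamma> = sets (grassmannian_borel m) \<and>
     (\<forall>g. orthogonal_transformation g \<and> det (matrix g) = 1 \<longrightarrow>
        (\<forall>A\<in>sets \<gamma>. emeasure \<gamma> ((`) g ` A) = emeasure \<gamma> A))"

end

theory Submission
  imports Defs
begin

text \<open>
  A projection is nonexpansive and maps into an \<open>m\<close>-dimensional space, so for every \<open>V\<close> the dimension
  of the projection is at most the minimum. The substance is the lower bound for almost all \<open>V\<close>.

  Let \<open>u < s < m\<close> with \<open>s\<close> below the dimension of \<open>E\<close>, and let \<open>a\<close> be large. The limit as
  \<open>\<theta>\<close> tends to \<open>0\<close> is an infimum, so the intermediate dimension of \<open>E\<close> with parameter \<open>\<theta> / a\<close> exceeds
  \<open>s\<close> as well, and at suitable small scales \<open>\<delta>\<close> there are no cheap covers of \<open>E\<close> with diameters between \<open>\<delta> powr (a / \<theta>)\<close> and \<open>\<delta>\<close>.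
  By \<open>discrete_Frostman\<close>, \<open>E\<close> then carries a finitely supported probability measure giving mass at
  most a multiple of \<open>r powr s\<close> to balls around its points with radius \<open>r\<close> in that range. By rotation
  invariance, the proportion of \<open>V\<close> with \<open>norm (orth_proj V x) \<le> r\<close> is at most a multiple of
  \<open>(r / norm x) ^ m\<close> (\<open>measure_small_projection_le\<close>). Averaged over \<open>V\<close>, the mass of pairs of points whose
  projections are \<open>r\<close>-close is therefore bounded by a multiple of \<open>r powr s + (r / \<delta>) ^ m\<close>, the second
  term coming from pairs at distance more than \<open>\<delta>\<close>.

  That second term is the obstacle for a fixed \<open>\<theta>\<close>, and it disappears here: if \<open>a * (m - s) \<ge> m\<close>, it is
  dominated by \<open>r powr s\<close> as soon as \<open>r \<le> \<delta> ^ a\<close> (\<open>scale_ratio_bound\<close>). The scales between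
  \<open>\<delta> powr (a / \<theta>)\<close> and \<open>\<delta> ^ a\<close> that remain are those of parameter \<open>\<theta>\<close> at scale \<open>\<delta> ^ a\<close>. Replacing
  \<open>\<theta>\<close> by \<open>\<theta> / a\<close> costs nothing in the limit \<open>\<theta> \<longlonglongrightarrow> 0\<close>.

  Weighting the close pairs with \<open>r powr - u\<close> and summing over dyadic \<open>r\<close> gives an energy whose mean is
  at most a multiple of \<open>(\<delta> ^ a) powr (s - u)\<close>. Along a geometrically decreasing sequence of scales
  these means are summable, so for almost every \<open>V\<close> the energies are bounded
  (\<open>AE_no_projected_covers\<close>). By the inequality of Cauchy and Schwarz, a bounded energy rules
  out cheap covers of the projection with exponent \<open>u\<close> (\<open>cover_sum_times_energy_ge_1\<close>).
\<close>

section \<open>Covers with diameters in a prescribed range\<close>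

definition has_cover :: "real \<Rightarrow> real \<Rightarrow> real \<Rightarrow> real \<Rightarrow> 'a::metric_space set \<Rightarrow> bool" where
  "has_cover \<theta> \<delta> s \<epsilon> F \<longleftrightarrow>
     (\<exists>\<U>. admissible_cover \<theta> \<delta> F \<U> \<and> diameter_sum s \<U> \<le> ennreal \<epsilon>)"

lemma has_coverI_finite:
  assumes "finite \<U>" "admissible_cover \<theta> \<delta> F \<U>" "(\<Sum>U\<in>\<U>. diameter U powr s) \<le> \<epsilon>"
  shows "has_cover \<theta> \<delta> s \<epsilon> F"
  using assms unfolding has_cover_def diameter_sum_def
  by (intro exI[of _ \<U>]) (simp add: sum_ennreal ennreal_leI)

text \<open>
  The lower bound on the diameters keeps every summand away from \<open>0\<close>, so an infinite family would
  have an infinite sum. From here on, all sums of diameters are finite real sums.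
\<close>

lemma has_coverE_finite:
  assumes hc: "has_cover \<theta> \<delta> s \<epsilon> F" and "0 < \<delta>" "0 \<le> s" "0 \<le> \<epsilon>"
  obtains \<U> where "finite \<U>" "admissible_cover \<theta> \<delta> F \<U>" "(\<Sum>U\<in>\<U>. diameter U powr s) \<le> \<epsilon>"
proof -
  obtain \<U> where \<U>: "admissible_cover \<theta> \<delta> F \<U>" "diameter_sum s \<U> \<le> ennreal \<epsilon>"
    using hc by (auto simp: has_cover_def)
  define b where "b = (\<delta> powr (1/\<theta>)) powr s"
  have b: "0 < ennreal b" "\<And>U. U \<in> \<U> \<Longrightarrow> ennreal b \<le> ennreal (diameter U powr s)"
    using assms \<U>(1) by (auto simp: b_def admissible_cover_def intro!: ennreal_leI powr_mono2)
  have "finite \<U>"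
  proof (rule ccontr)
    assume "infinite \<U>"
    then have "diameter_sum s \<U> = \<infinity>"
      unfolding diameter_sum_def
      using b by (intro infsum_superconst_infinite_ennreal[of \<U> "ennreal b"]) auto
    then show False using \<U>(2) by (simp add: top_unique)
  qed
  moreover have "(\<Sum>U\<in>\<U>. diameter U powr s) \<le> \<epsilon>"
    using \<U>(2) \<open>finite \<U>\<close> \<open>0 \<le> \<epsilon>\<close> by (simp add: diameter_sum_def sum_ennreal)
  ultimately show thesis using \<U>(1) that by blast
qed

lemma has_cover_mono_exponent:
  assumes hc: "has_cover \<theta> \<delta> s \<epsilon> F" and "0 < \<delta>" "\<delta> \<le> 1" "0 \<le> s" "s \<le> t" "0 \<le> \<epsilon>"
  shows "has_cover \<theta> \<delta> t \<epsilon> F"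
proof -
  obtain \<U> where \<U>: "finite \<U>" "admissible_cover \<theta> \<delta> F \<U>" "(\<Sum>U\<in>\<U>. diameter U powr s) \<le> \<epsilon>"
    using has_coverE_finite[of \<theta> \<delta> s \<epsilon> F thesis] assms by blast
  have "(\<Sum>U\<in>\<U>. diameter U powr t) \<le> (\<Sum>U\<in>\<U>. diameter U powr s)"
    using \<U>(2) assms by (intro sum_mono powr_mono') (auto simp: admissible_cover_def diameter_ge_0 intro: order_trans)
  then show ?thesis
    using \<U> by (intro has_coverI_finite[of \<U>]) auto
qed

lemma has_cover_mono_range:
  assumes "has_cover \<theta> \<delta> s \<epsilon> F" "\<delta>' powr (1/\<theta>') \<le> \<delta> powr (1/\<theta>)" "\<delta> \<le> \<delta>'" 
  shows "has_cover \<theta>' \<delta>' s \<epsilon> F"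
  using assms unfolding has_cover_def admissible_cover_def by (meson order_trans)

lemma has_cover_mono_theta:
  assumes "has_cover \<theta> \<delta> s \<epsilon> F" "0 < \<theta>'" "\<theta>' \<le> \<theta>" "0 < \<delta>" "\<delta> \<le> 1"
  shows "has_cover \<theta>' \<delta> s \<epsilon> F"
  using assms by (intro has_cover_mono_range[OF assms(1)] powr_mono') (auto intro: frac_le)

text \<open>
  A nonexpansive map may shrink a covering set below the smallest admissible diameter. Thickening
  its image by a ball repairs this, because thickening moves the diameter by an exactly known amount.
\<close>

lemma diameter_Minkowski_cball:
  fixes S :: "'a::euclidean_space set"
  assumes "bounded S" "S \<noteq> {}" "0 \<le> r"
  shows "diameter (\<Union>x\<in>S. cball x r) = diameter S + 2 * r"
    and "bounded (\<Union>x\<in>S. cball x r)"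
proof -
  let ?T = "\<Union>x\<in>S. cball x r"
  obtain a where "a \<in> S" using assms by auto
  have up: "dist p q \<le> diameter S + 2 * r" if pq: "p \<in> ?T" "q \<in> ?T" for p q
  proof -
    obtain x y where xy: "x \<in> S" "dist x p \<le> r" "y \<in> S" "dist y q \<le> r" using pq by auto
    have "dist p q \<le> dist p x + dist x y + dist y q"
      by (meson add_right_mono dist_triangle order_trans)
    moreover have "dist x y \<le> diameter S"
      using xy assms by (intro diameter_bounded_bound)
    ultimately show ?thesis using xy by (simp add: dist_commute)
  qed
  show bT: "bounded ?T"
    using up unfolding bounded_two_points by blast
  have "diameter ?T \<le> diameter S + 2 * r"
    using up assms \<open>a \<in> S\<close> by (intro diameter_le) (auto simp: dist_norm)
  moreover have "diameter S \<le> diameter ?T - 2 * r"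
  proof (rule diameter_le)
    fix x y assume xy: "x \<in> S" "y \<in> S"
    \<comment> \<open>Push \<open>x\<close> away from \<open>y\<close> and \<open>y\<close> away from \<open>x\<close>, each by \<open>r\<close>.\<close>
    obtain e :: 'a where e: "norm e = 1" "x - y = norm (x - y) *\<^sub>R e"
    proof (cases "x = y")
      case True
      then show ?thesis using that vector_choose_size[of 1] by auto
    next
      case False
      then show ?thesis by (intro that[of "sgn (x - y)"]) (auto simp: norm_sgn sgn_div_norm)
    qed
    have eq: "(x + r *\<^sub>R e) - (y - r *\<^sub>R e) = (norm (x - y) + 2 * r) *\<^sub>R e"
    proof -
      have "(x + r *\<^sub>R e) - (y - r *\<^sub>R e) = (x - y) + (r *\<^sub>R e + r *\<^sub>R e)"
        by simp
      also have "\<dots> = norm (x - y) *\<^sub>R e + (r *\<^sub>R e + r *\<^sub>R e)"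
        using e(2) by metis
      also have "\<dots> = (norm (x - y) + 2 * r) *\<^sub>R e"
        by (simp only: mult_2 scaleR_add_left)
      finally show ?thesis .
    qed
    have "x + r *\<^sub>R e \<in> ?T" "y - r *\<^sub>R e \<in> ?T"
      using xy e assms by (auto simp: dist_norm intro: bexI[of _ x] bexI[of _ y])
    then have "dist (x + r *\<^sub>R e) (y - r *\<^sub>R e) \<le> diameter ?T"
      using bT by (intro diameter_bounded_bound)
    then show "norm (x - y) \<le> diameter ?T - 2 * r"
      using e assms unfolding dist_norm eq by simp
  qed (use assms in auto)
  ultimately show "diameter ?T = diameter S + 2 * r" by simp
qed

lemma superset_of_diameter:
  fixes S :: "'a::euclidean_space set"
  assumes "bounded S" "diameter S \<le> D" "0 \<le> D"
  obtains T where "S \<subseteq> T" "bounded T" "diameter T = D"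
proof (cases "S = {}")
  case True
  then show ?thesis using assms by (intro that[of "cball 0 (D/2)"]) auto
next
  case False
  show ?thesis
  proof (rule that)
    show "S \<subseteq> (\<Union>x\<in>S. cball x ((D - diameter S)/2))" using assms by force
    show "bounded (\<Union>x\<in>S. cball x ((D - diameter S)/2))"
      "diameter (\<Union>x\<in>S. cball x ((D - diameter S)/2)) = D"
      using assms False diameter_Minkowski_cball[of S "(D - diameter S)/2"] by (auto simp: field_simps)
  qed
qed

lemma has_cover_nonexpansive_image:
  fixes f :: "'a::metric_space \<Rightarrow> 'b::euclidean_space"
  assumes hc: "has_cover \<theta> \<delta> s \<epsilon> F" and "0 < \<delta>" "0 \<le> s" "0 \<le> \<epsilon>"
    and f: "\<And>x y. dist (f x) (f y) \<le> dist x y"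
  shows "has_cover \<theta> \<delta> s \<epsilon> (f ` F)"
proof -
  obtain \<U> where \<U>: "finite \<U>" "admissible_cover \<theta> \<delta> F \<U>" "(\<Sum>U\<in>\<U>. diameter U powr s) \<le> \<epsilon>"
    using has_coverE_finite[of \<theta> \<delta> s \<epsilon> F thesis] assms by blast
  have "\<exists>T. f ` U \<subseteq> T \<and> bounded T \<and> diameter T = diameter U" if "U \<in> \<U>" for U
  proof -
    have bU: "bounded U" using \<U> that by (auto simp: admissible_cover_def)
    then have d: "dist p q \<le> diameter U" if "p \<in> f ` U" "q \<in> f ` U" for p q
      using that by (auto intro!: order_trans[OF f] diameter_bounded_bound)
    have "bounded (f ` U)"
      using d unfolding bounded_two_points by blast
    moreover have "diameter (f ` U) \<le> diameter U"
      using d diameter_ge_0[OF bU] by (intro diameter_le) (auto simp: dist_norm)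
    ultimately show ?thesis
      using superset_of_diameter[of "f ` U" "diameter U"] diameter_ge_0[OF bU] by metis
  qed
  then obtain g where g: "\<And>U. U \<in> \<U> \<Longrightarrow> f ` U \<subseteq> g U \<and> bounded (g U) \<and> diameter (g U) = diameter U"
    by metis
  show ?thesis
  proof (rule has_coverI_finite)
    show "finite (g ` \<U>)" using \<U> by simp
    show "admissible_cover \<theta> \<delta> (f ` F) (g ` \<U>)"
      unfolding admissible_cover_def
    proof (intro conjI ballI)
      have "F \<subseteq> \<Union>\<U>" using \<U>(2) by (simp add: admissible_cover_def)
      then show "f ` F \<subseteq> \<Union>(g ` \<U>)" using g by blast
    qed (use \<U>(2) g in \<open>auto simp: admissible_cover_def\<close>)
    have "(\<Sum>U\<in>g ` \<U>. diameter U powr s) \<le> (\<Sum>U\<in>\<U>. diameter (g U) powr s)"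
      using sum_image_le[OF \<U>(1), of "\<lambda>U. diameter U powr s" g] by (simp add: o_def)
    also have "\<dots> = (\<Sum>U\<in>\<U>. diameter U powr s)" using g by (intro sum.cong) auto
    finally show "(\<Sum>U\<in>g ` \<U>. diameter U powr s) \<le> \<epsilon>" using \<U>(3) by simp
  qed
qed

lemma subspace_orthonormal_expansion:
  fixes B :: "'a::euclidean_space set"
  assumes "pairwise orthogonal B" "\<And>b. b \<in> B \<Longrightarrow> norm b = 1" "finite B" "x \<in> span B"
  shows "(\<Sum>b\<in>B. (x \<bullet> b) *\<^sub>R b) = x"
proof -
  obtain c where c: "x = (\<Sum>b\<in>B. c b *\<^sub>R b)"
    using assms span_finite[of B] by auto
  have "x \<bullet> b = c b" if "b \<in> B" for b
  proof -
    have "x \<bullet> b = (\<Sum>a\<in>B. c a * (a \<bullet> b))" by (simp add: c inner_sum_left)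
    also have "\<dots> = (\<Sum>a\<in>B. if a = b then c b else 0)"
      using assms that by (intro sum.cong) (auto simp: pairwise_def orthogonal_def dot_square_norm)
    finally show ?thesis using that assms by simp
  qed
  then show ?thesis using c by simp
qed

text \<open>
  In coordinates with respect to an orthonormal basis of \<open>V\<close>, a grid of mesh comparable to \<open>\<delta>\<close> has
  about \<open>\<delta> powr - dim V\<close> points in the ball of radius \<open>R\<close>, and the balls of diameter exactly \<open>\<delta>\<close>
  around them cover. The constant depends on \<open>V\<close> only through its dimension; the estimate of
  small projections relies on this uniformity.
\<close>

lemma subspace_ball_cover:
  fixes F V :: "'a::euclidean_space set"
  assumes V: "subspace V" "F \<subseteq> V" and R: "0 \<le> R" "\<And>x. x \<in> F \<Longrightarrow> norm x \<le> R"
    and \<theta>: "0 < \<theta>" "\<theta> \<le> 1" and \<delta>: "0 < \<delta>" "\<delta> \<le> 1"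
  shows "has_cover \<theta> \<delta> s ((4 * (real (dim V) + 1) * R + 5) ^ dim V * \<delta> powr (s - real (dim V))) F"
proof -
  define m where "m = dim V"
  define C where "C = (4 * (real m + 1) * R + 5) ^ m"
  obtain B where B: "B \<subseteq> V" "pairwise orthogonal B" "\<And>x. x \<in> B \<Longrightarrow> norm x = 1"
      "independent B" "card B = dim V" "span B = V"
    using orthonormal_basis_subspace[OF V(1)] by blast
  have fB: "finite B" using B(4) by (simp add: independent_imp_finite)
  define h where "h = \<delta> / (2 * (real m + 1))"
  have h: "0 < h" using \<delta> by (auto simp: h_def)
  define N where "N = \<lceil>R/h\<rceil> + 1"
  define K where "K = B \<rightarrow>\<^sub>E {-N..N}"
  define p where "p k = (\<Sum>b\<in>B. (h * of_int (k b)) *\<^sub>R b)" for k :: "'a \<Rightarrow> int"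
  define \<U> where "\<U> = (\<lambda>k. cball (p k) (\<delta>/2)) ` K"
  have N0: "0 \<le> N"
  proof -
    have "0 \<le> R / h" using R h by simp
    then show ?thesis unfolding N_def by linarith
  qed
  have fK: "finite K" using fB by (auto simp: K_def intro!: finite_PiE)
  have "real (card K) = (2 * real_of_int N + 1) ^ m"
    using fB N0 by (simp add: K_def card_PiE B(5) m_def)
  also have "\<dots> \<le> ((4 * (real m + 1) * R + 5) / \<delta>) ^ m"
  proof (rule power_mono)
    have "real_of_int N \<le> R / h + 2" by (simp add: N_def) linarith
    then have "2 * real_of_int N + 1 \<le> 2 * (R/h + 2) + 1" by simp
    also have "2 * (R/h + 2) + 1 = (4 * (real m + 1) * R + 5 * \<delta>) / \<delta>"
      using \<delta> by (simp add: h_def field_simps)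
    also have "\<dots> \<le> (4 * (real m + 1) * R + 5) / \<delta>"
      using \<delta> by (intro divide_right_mono) auto
    finally show "2 * real_of_int N + 1 \<le> (4 * (real m + 1) * R + 5) / \<delta>" .
  qed (use N0 in auto)
  also have "\<dots> = C * \<delta> powr (- real m)"
    using \<delta> by (simp add: C_def powr_minus powr_realpow divide_inverse power_mult_distrib power_inverse)
  finally have card: "real (card K) \<le> C * \<delta> powr (- real m)" .
  have "has_cover \<theta> \<delta> s (C * \<delta> powr (s - real (dim V))) F"
  proof (rule has_coverI_finite)
    show "finite \<U>" using fK by (simp add: \<U>_def)
    have "\<exists>k\<in>K. x \<in> cball (p k) (\<delta>/2)" if x: "x \<in> F" for x
    proof
      define k where "k = (\<lambda>b\<in>B. \<lfloor>(x \<bullet> b) / h\<rfloor>)"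
      show "k \<in> K"
      proof -
        have "\<lfloor>(x \<bullet> b) / h\<rfloor> \<in> {-N..N}" if b: "b \<in> B" for b
        proof -
          have "\<bar>x \<bullet> b\<bar> \<le> R"
            using Cauchy_Schwarz_ineq2[of x b] B(3)[OF b] R(2)[OF x] by simp
          then have "\<bar>(x \<bullet> b) / h\<bar> \<le> R / h"
            using h by (simp add: divide_right_mono)
          then have "\<bar>(x \<bullet> b) / h\<bar> \<le> real_of_int \<lceil>R / h\<rceil>" by linarith
          then show ?thesis unfolding N_def atLeastAtMost_iff by linarith
        qed
        then show ?thesis by (auto simp: K_def k_def)
      qed
      have "x - p k = (\<Sum>b\<in>B. (x \<bullet> b - h * of_int \<lfloor>(x \<bullet> b) / h\<rfloor>) *\<^sub>R b)"
        using subspace_orthonormal_expansion[of B x] B fB x V(2)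
        by (auto simp: p_def k_def scaleR_diff_left sum_subtractf intro!: sum.cong)
      also have "norm \<dots> \<le> (\<Sum>b\<in>B. h)"
      proof (rule sum_norm_le)
        fix b assume b: "b \<in> B"
        have "x \<bullet> b - h * of_int \<lfloor>(x \<bullet> b) / h\<rfloor> = h * ((x \<bullet> b) / h - of_int \<lfloor>(x \<bullet> b) / h\<rfloor>)"
          using h by (simp add: right_diff_distrib)
        then have "\<bar>x \<bullet> b - h * of_int \<lfloor>(x \<bullet> b) / h\<rfloor>\<bar> = h * \<bar>(x \<bullet> b) / h - of_int \<lfloor>(x \<bullet> b) / h\<rfloor>\<bar>"
          using h by (simp only: abs_mult abs_of_pos)
        also have "\<dots> \<le> h * 1" using h by (intro mult_left_mono) linarith+
        finally show "norm ((x \<bullet> b - h * of_int \<lfloor>(x \<bullet> b) / h\<rfloor>) *\<^sub>R b) \<le> h"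
          using B(3)[OF b] by simp
      qed
      also have "\<dots> \<le> \<delta>/2" using B(5) \<delta> by (simp add: h_def m_def field_simps)
      finally show "x \<in> cball (p k) (\<delta>/2)" by (simp add: dist_norm norm_minus_commute)
    qed
    moreover have "\<delta> powr (1/\<theta>) \<le> \<delta>"
      using powr_mono'[of 1 "1/\<theta>" \<delta>] \<theta> \<delta> by simp
    ultimately show "admissible_cover \<theta> \<delta> F \<U>"
      using \<delta> by (auto simp: admissible_cover_def \<U>_def)
    have "(\<Sum>U\<in>\<U>. diameter U powr s) \<le> (\<Sum>k\<in>K. \<delta> powr s)"
      using sum_image_le[OF fK, of "\<lambda>U. diameter U powr s" "\<lambda>k. cball (p k) (\<delta>/2)"] \<delta>
      by (simp add: o_def \<U>_def)
    also have "\<dots> \<le> (C * \<delta> powr (- real m)) * \<delta> powr s"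
      using card by (simp add: mult_right_mono)
    also have "\<dots> = C * \<delta> powr (s - real (dim V))"
      by (simp add: m_def flip: powr_add)
    finally show "(\<Sum>U\<in>\<U>. diameter U powr s) \<le> C * \<delta> powr (s - real (dim V))" .
  qed
  then show ?thesis by (simp add: C_def m_def)
qed

section \<open>Intermediate dimensions and their limits\<close>

text \<open>
  Lower and upper dimensions differ only in how the scale \<open>\<delta>\<close> is quantified: frequently or eventually
  as \<open>\<delta>\<close> tends to \<open>0\<close> from above. The two properties assumed of the quantifier \<open>Q\<close> hold in both cases
  and suffice for everything except the lower bound for projections.
\<close>

locale small_scales =
  fixes Q :: "(real \<Rightarrow> bool) \<Rightarrow> bool"
  assumes Q_mono: "\<lbrakk>\<forall>\<^sub>F \<delta> in at_right 0. P \<delta> \<longrightarrow> P' \<delta>; Q P\<rbrakk> \<Longrightarrow> Q P'"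
    and Q_eventually: "\<forall>\<^sub>F \<delta> in at_right 0. P \<delta> \<Longrightarrow> Q P"
begin

definition exponents :: "real \<Rightarrow> 'a::metric_space set \<Rightarrow> real set" where
  "exponents \<theta> F = {s. 0 \<le> s \<and> (\<forall>\<epsilon>>0. Q (\<lambda>\<delta>. has_cover \<theta> \<delta> s \<epsilon> F))}"

definition intermediate_dim :: "real \<Rightarrow> 'a::metric_space set \<Rightarrow> real" where
  "intermediate_dim \<theta> F = Inf (exponents \<theta> F)"

definition quasi_Hausdorff_dim :: "'a::metric_space set \<Rightarrow> real" where
  "quasi_Hausdorff_dim F = Lim (at_right 0) (\<lambda>\<theta>. intermediate_dim \<theta> F)"

lemma bdd_below_exponents: "bdd_below (exponents \<theta> F)"
  by (rule bdd_belowI[of _ 0]) (auto simp: exponents_def)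

lemma eventually_unit_interval: "\<forall>\<^sub>F \<delta> in at_right (0::real). 0 < \<delta> \<and> \<delta> \<le> 1"
  using eventually_at_right_real[of 0 1] by (auto elim: eventually_mono)

lemma exponents_of_large:
  fixes F V :: "'a::euclidean_space set"
  assumes V: "subspace V" "F \<subseteq> V" "bounded F" and \<theta>: "0 < \<theta>" "\<theta> \<le> 1" and s: "real (dim V) < s"
  shows "s \<in> exponents \<theta> F"
proof -
  obtain R where R: "0 < R" "\<And>x. x \<in> F \<Longrightarrow> norm x \<le> R"
    using V(3) bounded_pos by blast
  define C where "C = (4 * (real (dim V) + 1) * R + 5) ^ dim V"
  have "\<forall>\<^sub>F \<delta> in at_right 0. has_cover \<theta> \<delta> s \<epsilon> F" if "0 < \<epsilon>" for \<epsilon>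
  proof -
    have "((\<lambda>\<delta>. C * \<delta> powr (s - real (dim V))) \<longlongrightarrow> C * 0) (at_right 0)"
      using s by (intro tendsto_intros tendsto_zero_powrI) (auto intro: eventually_mono[OF eventually_unit_interval])
    then have "\<forall>\<^sub>F \<delta> in at_right 0. C * \<delta> powr (s - real (dim V)) < \<epsilon>"
      using that by (auto dest: order_tendstoD)
    then show ?thesis
      using eventually_unit_interval
    proof eventually_elim
      case (elim \<delta>)
      then have "has_cover \<theta> \<delta> s (C * \<delta> powr (s - real (dim V))) F"
        using s \<theta> R elim unfolding C_def by (intro subspace_ball_cover V) auto
      then show ?case
        using elim unfolding has_cover_def by (meson ennreal_leI less_imp_le order_trans)
    qed
  qed
  then show ?thesis using s by (auto simp: exponents_def intro: Q_eventually)
qed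

lemma exponents_nonempty:
  fixes F :: "'a::euclidean_space set"
  assumes "bounded F" "0 < \<theta>" "\<theta> \<le> 1"
  shows "exponents \<theta> F \<noteq> {}"
  using exponents_of_large[of UNIV F \<theta> "DIM('a) + 1"] assms by auto

lemma intermediate_dim_le_dim:
  fixes F V :: "'a::euclidean_space set"
  assumes "subspace V" "F \<subseteq> V" "bounded F" "0 < \<theta>" "\<theta> \<le> 1"
  shows "intermediate_dim \<theta> F \<le> real (dim V)"
proof (rule field_le_epsilon)
  fix e :: real assume "0 < e"
  then have "real (dim V) + e \<in> exponents \<theta> F"
    using assms exponents_of_large[of V F \<theta> "real (dim V) + e"] by auto
  then show "intermediate_dim \<theta> F \<le> real (dim V) + e"
    unfolding intermediate_dim_def by (intro cInf_lower bdd_below_exponents)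
qed

lemma intermediate_dim_nonneg:
  fixes F :: "'a::euclidean_space set"
  assumes "bounded F" "0 < \<theta>" "\<theta> \<le> 1"
  shows "0 \<le> intermediate_dim \<theta> F"
  unfolding intermediate_dim_def
  using exponents_nonempty[OF assms] by (intro cInf_greatest) (auto simp: exponents_def)

lemma intermediate_dim_mono:
  fixes F :: "'a::euclidean_space set"
  assumes "bounded F" "0 < \<theta>'" "\<theta>' \<le> \<theta>" "\<theta> \<le> 1"
  shows "intermediate_dim \<theta>' F \<le> intermediate_dim \<theta> F"
  unfolding intermediate_dim_def
proof (rule cInf_superset_mono)
  show "exponents \<theta> F \<subseteq> exponents \<theta>' F"
  proof
    fix s assume s: "s \<in> exponents \<theta> F"
    have "Q (\<lambda>\<delta>. has_cover \<theta>' \<delta> s \<epsilon> F)" if "0 < \<epsilon>" for \<epsilon>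
    proof (rule Q_mono)
      show "\<forall>\<^sub>F \<delta> in at_right 0. has_cover \<theta> \<delta> s \<epsilon> F \<longrightarrow> has_cover \<theta>' \<delta> s \<epsilon> F"
        using eventually_unit_interval
        by eventually_elim (use assms has_cover_mono_theta in blast)
    qed (use s that in \<open>auto simp: exponents_def\<close>)
    then show "s \<in> exponents \<theta>' F" using s by (auto simp: exponents_def)
  qed
qed (use assms exponents_nonempty[of F \<theta>] bdd_below_exponents[of \<theta>' F] in auto)

lemma intermediate_dim_nonexpansive_image:
  fixes F :: "'a::euclidean_space set" and f :: "'a \<Rightarrow> 'b::euclidean_space"
  assumes "bounded F" "0 < \<theta>" "\<theta> \<le> 1" and f: "\<And>x y. dist (f x) (f y) \<le> dist x y"
  shows "intermediate_dim \<theta> (f ` F) \<le> intermediate_dim \<theta> F"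
  unfolding intermediate_dim_def
proof (rule cInf_superset_mono)
  show "exponents \<theta> F \<subseteq> exponents \<theta> (f ` F)"
  proof
    fix s assume s: "s \<in> exponents \<theta> F"
    have "Q (\<lambda>\<delta>. has_cover \<theta> \<delta> s \<epsilon> (f ` F))" if "0 < \<epsilon>" for \<epsilon>
    proof (rule Q_mono)
      show "\<forall>\<^sub>F \<delta> in at_right 0. has_cover \<theta> \<delta> s \<epsilon> F \<longrightarrow> has_cover \<theta> \<delta> s \<epsilon> (f ` F)"
        using eventually_unit_interval
        by eventually_elim (use f s that has_cover_nonexpansive_image[of \<theta> _ s \<epsilon> F f] in \<open>auto simp: exponents_def\<close>)
    qed (use s that in \<open>auto simp: exponents_def\<close>)
    then show "s \<in> exponents \<theta> (f ` F)" using s by (auto simp: exponents_def)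
  qed
qed (use assms exponents_nonempty[of F \<theta>] bdd_below_exponents[of \<theta> "f ` F"] in auto)

text \<open>
  Below diameter \<open>1\<close> the sums decrease in the exponent, so one failing exponent \<open>u\<close> excludes all
  smaller ones.
\<close>

lemma intermediate_dim_ge:
  fixes F :: "'a::euclidean_space set"
  assumes "bounded F" "0 < \<theta>" "\<theta> \<le> 1" "0 < \<epsilon>"
    and no: "\<not> Q (\<lambda>\<delta>. has_cover \<theta> \<delta> u \<epsilon> F)"
  shows "u \<le> intermediate_dim \<theta> F"
  unfolding intermediate_dim_def
proof (rule cInf_greatest)
  fix s assume s: "s \<in> exponents \<theta> F"
  show "u \<le> s"
  proof (rule ccontr)
    assume "\<not> u \<le> s"
    then have "\<forall>\<^sub>F \<delta> in at_right 0. has_cover \<theta> \<delta> s \<epsilon> F \<longrightarrow> has_cover \<theta> \<delta> u \<epsilon> F"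
      using s \<open>0 < \<epsilon>\<close>
      by (intro eventually_mono[OF eventually_unit_interval])
         (auto simp: exponents_def intro: has_cover_mono_exponent)
    moreover have "Q (\<lambda>\<delta>. has_cover \<theta> \<delta> s \<epsilon> F)" using s \<open>0 < \<epsilon>\<close> by (auto simp: exponents_def)
    ultimately show False using no Q_mono[of "\<lambda>\<delta>. has_cover \<theta> \<delta> s \<epsilon> F" "\<lambda>\<delta>. has_cover \<theta> \<delta> u \<epsilon> F"] by blast
  qed
qed (use assms exponents_nonempty in auto)

lemma no_cover_below_intermediate_dim:
  assumes "0 \<le> s" "s < intermediate_dim \<theta> F"
  obtains \<epsilon> where "0 < \<epsilon>" "\<not> Q (\<lambda>\<delta>. has_cover \<theta> \<delta> s \<epsilon> F)"
proof -
  have "s \<notin> exponents \<theta> F"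
    using assms cInf_lower[OF _ bdd_below_exponents] unfolding intermediate_dim_def by fastforce
  then show thesis using assms that by (auto simp: exponents_def)
qed

text \<open>The limit exists since the dimension is monotone in \<open>\<theta>\<close> and bounded below.\<close>

lemma tendsto_quasi_Hausdorff_dim:
  fixes F :: "'a::euclidean_space set"
  assumes F: "bounded F"
  shows "((\<lambda>\<theta>. intermediate_dim \<theta> F) \<longlongrightarrow> quasi_Hausdorff_dim F) (at_right 0)"
proof -
  let ?I = "INF \<theta>\<in>{0<..1}. intermediate_dim \<theta> F"
  have bdd: "bdd_below ((\<lambda>\<theta>. intermediate_dim \<theta> F) ` {0<..1})"
    using intermediate_dim_nonneg[OF F] by (intro bdd_belowI[of _ 0]) auto
  have "((\<lambda>\<theta>. intermediate_dim \<theta> F) \<longlongrightarrow> ?I) (at_right 0)"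
  proof (rule order_tendstoI)
    fix a assume "a < ?I"
    then have "a < intermediate_dim \<theta> F" if "0 < \<theta> \<and> \<theta> \<le> 1" for \<theta>
      using that cINF_lower[OF bdd, of \<theta>] by auto
    then show "\<forall>\<^sub>F \<theta> in at_right 0. a < intermediate_dim \<theta> F"
      using eventually_unit_interval by (auto elim: eventually_mono)
  next
    fix a assume "?I < a"
    then obtain \<theta>' where \<theta>': "0 < \<theta>'" "\<theta>' \<le> 1" "intermediate_dim \<theta>' F < a"
      using cINF_less_iff[OF _ bdd] by auto
    have "\<forall>\<^sub>F \<theta> in at_right 0. \<theta> \<in> {0<..<\<theta>'}"
      using \<theta>' by (intro eventually_at_right_real)
    then show "\<forall>\<^sub>F \<theta> in at_right 0. intermediate_dim \<theta> F < a"
    proof eventually_elim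
      case (elim \<theta>)
      then show ?case using intermediate_dim_mono[OF F, of \<theta> \<theta>'] \<theta>' by auto
    qed
  qed
  then show ?thesis unfolding quasi_Hausdorff_dim_def by (simp add: tendsto_Lim)
qed

lemma quasi_Hausdorff_dim_le_intermediate_dim:
  fixes F :: "'a::euclidean_space set"
  assumes "bounded F" "0 < \<theta>" "\<theta> \<le> 1"
  shows "quasi_Hausdorff_dim F \<le> intermediate_dim \<theta> F"
proof (rule tendsto_upperbound[OF tendsto_quasi_Hausdorff_dim])
  have "\<forall>\<^sub>F \<theta>' in at_right 0. \<theta>' \<in> {0<..<\<theta>}"
    using assms by (intro eventually_at_right_real)
  then show "\<forall>\<^sub>F \<theta>' in at_right 0. intermediate_dim \<theta>' F \<le> intermediate_dim \<theta> F"
    by eventually_elim (use assms in \<open>auto intro!: intermediate_dim_mono\<close>)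
qed (use assms in auto)

lemma quasi_Hausdorff_dim_ge:
  fixes F :: "'a::euclidean_space set"
  assumes "bounded F" "\<And>\<theta>. \<lbrakk>0 < \<theta>; \<theta> \<le> 1\<rbrakk> \<Longrightarrow> c \<le> intermediate_dim \<theta> F"
  shows "c \<le> quasi_Hausdorff_dim F"
  using eventually_unit_interval
  by (intro tendsto_lowerbound[OF tendsto_quasi_Hausdorff_dim[OF assms(1)]])
     (use assms in \<open>auto elim!: eventually_mono\<close>)

end

interpretation lower: small_scales "\<lambda>P. \<exists>\<^sub>F \<delta> in at_right 0. P \<delta>"
proof
  show "\<exists>\<^sub>F \<delta> in at_right 0. P \<delta>" if "\<forall>\<^sub>F \<delta> in at_right 0. P \<delta>" for P :: "real \<Rightarrow> bool"
    using that by (intro eventually_frequently) auto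
qed (rule frequently_mp)

interpretation upper: small_scales "\<lambda>P. \<forall>\<^sub>F \<delta> in at_right 0. P \<delta>"
  by standard (auto elim: eventually_elim2)

lemma eventually_at_right_0_iff:
  "(\<forall>\<^sub>F \<delta> in at_right (0::real). P \<delta>) \<longleftrightarrow> (\<exists>\<delta>\<^sub>0>0. \<forall>\<delta>. 0 < \<delta> \<and> \<delta> \<le> \<delta>\<^sub>0 \<longrightarrow> P \<delta>)"
  unfolding eventually_at_right_field
  by (metis field_lbound_gt_zero le_less_trans less_imp_le)

lemma frequently_at_right_0_iff:
  "(\<exists>\<^sub>F \<delta> in at_right (0::real). P \<delta>) \<longleftrightarrow> (\<forall>\<delta>\<^sub>0>0. \<exists>\<delta>. 0 < \<delta> \<and> \<delta> \<le> \<delta>\<^sub>0 \<and> P \<delta>)"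
  unfolding frequently_def eventually_at_right_0_iff by auto

lemma lower_quasi_Hausdorff_dim_eq: "lower_quasi_Hausdorff_dim F = lower.quasi_Hausdorff_dim F"
  unfolding lower_quasi_Hausdorff_dim_def lower.quasi_Hausdorff_dim_def lower.intermediate_dim_def
    lower_intermediate_dim_def lower.exponents_def has_cover_def
  unfolding frequently_at_right_0_iff ..

lemma upper_quasi_Hausdorff_dim_eq: "upper_quasi_Hausdorff_dim F = upper.quasi_Hausdorff_dim F"
  unfolding upper_quasi_Hausdorff_dim_def upper.quasi_Hausdorff_dim_def upper.intermediate_dim_def
    upper_intermediate_dim_def upper.exponents_def has_cover_def
  unfolding eventually_at_right_0_iff ..

section \<open>The proportion of subspaces that nearly annihilate a vector\<close>

lemma norm_orth_proj_le:
  fixes V :: "'a::euclidean_space set"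
  assumes V: "subspace V"
  shows "norm (orth_proj V x) \<le> norm x" and norm_diff_orth_proj_le: "norm (x - orth_proj V x) \<le> norm x"
proof -
  have "orthogonal (orth_proj V x) (x - orth_proj V x)"
    using orth_proj_orthogonal[OF V orth_proj_in[OF V]] by (simp add: orthogonal_commute)
  then have "(norm x)\<^sup>2 = (norm (orth_proj V x))\<^sup>2 + (norm (x - orth_proj V x))\<^sup>2"
    using norm_add_Pythagorean by fastforce
  then show "norm (orth_proj V x) \<le> norm x" "norm (x - orth_proj V x) \<le> norm x"
    by (simp_all add: power2_le_imp_le)
qed

lemma dist_orth_proj_le:
  fixes V :: "'a::euclidean_space set"
  assumes "subspace V"
  shows "dist (orth_proj V x) (orth_proj V y) \<le> dist x y"
  using norm_orth_proj_le[OF assms, of "x - y"] by (simp add: dist_norm linear_diff linear_orth_proj assms)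

lemma orth_proj_orthogonal_image:
  fixes V :: "'a::euclidean_space set"
  assumes V: "subspace V" and g: "orthogonal_transformation g"
  shows "orth_proj (g ` V) (g x) = g (orth_proj V x)"
proof -
  have lin: "linear g" using g by (rule orthogonal_transformation_linear)
  show ?thesis
  proof (rule orth_proj_unique)
    show "subspace (g ` V)" using lin V by (rule linear_subspace_image)
    show "g (orth_proj V x) \<in> g ` V" using V by (simp add: orth_proj_in)
    fix w assume "w \<in> g ` V"
    then obtain v where v: "v \<in> V" "w = g v" by blast
    have "(g x - g (orth_proj V x)) \<bullet> g v = (x - orth_proj V x) \<bullet> v"
      using g lin by (simp add: orthogonal_transformation_def flip: linear_diff)
    then show "orthogonal (g x - g (orth_proj V x)) w"
      using orth_proj_orthogonal[OF V v(1), of x] v by (simp add: orthogonal_def)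
  qed
qed

lemma space_grassmannian_haar:
  assumes "grassmannian_haar m \<gamma>"
  shows "space \<gamma> = grassmannian m"
proof -
  have "sets \<gamma> = sets (grassmannian_borel m)"
    using assms by (simp add: grassmannian_haar_def)
  then have "space \<gamma> = space (grassmannian_borel m)" by (rule sets_eq_imp_space_eq)
  then show ?thesis by (simp add: grassmannian_borel_def space_measure_of_conv)
qed

text \<open>
  The metric on the Grassmannian is the operator norm distance of the projections, so evaluation at
  \<open>x\<close> is continuous.
\<close>

lemma measurable_orth_proj:
  fixes x :: "real ^ 'n"
  assumes \<gamma>: "grassmannian_haar m \<gamma>"
  shows "(\<lambda>V. orth_proj V x) \<in> borel_measurable \<gamma>"
proof (rule borel_measurableI)
  interpret G: Metric_space "grassmannian m :: (real ^ 'n) set set" grassmannian_dist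
    by (rule Metric_space_grassmannian)
  fix S :: "(real ^ 'n) set" assume S: "open S"
  let ?U = "(\<lambda>V. orth_proj V x) -` S \<inter> space \<gamma>"
  have "openin G.mtopology ?U"
    unfolding G.openin_mtopology
  proof (intro conjI allI impI)
    show "?U \<subseteq> grassmannian m" using space_grassmannian_haar[OF \<gamma>] by auto
    fix V assume V: "V \<in> ?U"
    then obtain e where e: "0 < e" "ball (orth_proj V x) e \<subseteq> S"
      using S by (auto elim: openE)
    have "W \<in> ?U" if W: "W \<in> G.mball V (e / (norm x + 1))" for W
    proof -
      have VW: "V \<in> grassmannian m" "W \<in> grassmannian m"
        and less: "grassmannian_dist V W < e / (norm x + 1)"
        using W by (auto simp: G.in_mball)
      then have sub: "subspace V" "subspace W" by (auto simp: grassmannian_def)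
      have bl: "bounded_linear (\<lambda>x. orth_proj V x - orth_proj W x)"
        using sub by (intro bounded_linear_sub linear_conv_bounded_linear[THEN iffD1] linear_orth_proj)
      have "norm (orth_proj V x - orth_proj W x) \<le> grassmannian_dist V W * norm x"
        using onorm[OF bl, of x] sub by (simp add: grassmannian_dist_def)
      also have "\<dots> \<le> e / (norm x + 1) * norm x"
        using less by (intro mult_right_mono) auto
      also have "\<dots> < e"
      proof -
        have "0 < 1 + norm x" by (simp add: add_pos_nonneg)
        then show ?thesis using e by (simp add: field_simps)
      qed
      finally show ?thesis
        using e VW space_grassmannian_haar[OF \<gamma>] by (auto simp: dist_norm)
    qed
    then show "\<exists>r>0. G.mball V r \<subseteq> ?U"
      using e by (intro exI[of _ "e / (norm x + 1)"]) (auto simp: add_nonneg_pos)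
  qed
  moreover have "sets \<gamma> = sigma_sets (grassmannian m) {A. openin G.mtopology A}"
    using \<gamma> by (simp add: grassmannian_haar_def grassmannian_borel_def sets_measure_of_conv)
      (use openin_subset in fastforce)
  ultimately show "?U \<in> sets \<gamma>" by auto
qed

text \<open>
  The set is contained in the \<open>r\<close>-neighbourhood of the unit ball of the orthogonal complement \<open>W\<close>
  of \<open>V\<close>. About \<open>r powr - dim W\<close> balls of radius comparable to \<open>r\<close> cover it, and each has volume
  comparable to \<open>r ^ DIM('a)\<close>.
\<close>

lemma measure_ball_slab_le:
  fixes V :: "'a::euclidean_space set"
  assumes V: "subspace V" and r: "0 < r" "r \<le> 1"
  shows "measure lebesgue {y \<in> cball 0 1. norm (orth_proj V y) \<le> r}
      \<le> real (8 * DIM('a) + 18) ^ DIM('a) * measure lebesgue (cball (0::'a) 1) * r ^ dim V"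
    and "compact {y \<in> cball 0 1. norm (orth_proj V y) \<le> r}"
proof -
  let ?S = "{y \<in> cball 0 1. norm (orth_proj V y) \<le> r}" and ?d = "DIM('a)"
  have "continuous_on UNIV (orth_proj V)"
    using linear_orth_proj[OF V] by (simp add: linear_continuous_on linear_conv_bounded_linear)
  then have "closed {y. norm (orth_proj V y) \<le> r}"
    by (intro closed_Collect_le continuous_intros)
  then have "compact (cball 0 1 \<inter> {y. norm (orth_proj V y) \<le> r})"
    by (intro compact_Int_closed compact_cball)
  then show cS: "compact ?S" by (simp add: Int_def)
  define W where "W = {y. \<forall>v\<in>V. orthogonal v y}"
  have W: "subspace W" unfolding W_def by (rule subspace_orthogonal_to_vectors)
  have dimW: "dim W + dim V = ?d"
    using dim_subspace_orthogonal_to_vectors[OF V subspace_UNIV] by (simp add: W_def)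
  \<comment> \<open>With exponent 0 the sum of powers counts the covering sets; \<open>\<theta> = 1\<close> forces the diameter \<open>r\<close>.\<close>
  have "has_cover 1 r 0 ((4 * (real (dim W) + 1) * 1 + 5) ^ dim W * r powr (0 - real (dim W))) (W \<inter> cball 0 1)"
    using r by (intro subspace_ball_cover W) auto
  then obtain \<U> where \<U>: "finite \<U>" "admissible_cover 1 r (W \<inter> cball 0 1) \<U>"
      "(\<Sum>U\<in>\<U>. diameter U powr 0) \<le> (4 * (real (dim W) + 1) * 1 + 5) ^ dim W * r powr (0 - real (dim W))"
    using r by (elim has_coverE_finite) auto
  have U: "bounded U" "diameter U = r" "U \<noteq> {}" if "U \<in> \<U>" for U
    using \<U>(2) that r by (auto simp: admissible_cover_def)
  have "real (card \<U>) = (\<Sum>U\<in>\<U>. diameter U powr 0)"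
    using U r by simp
  also have "\<dots> \<le> (4 * (real (dim W) + 1) * 1 + 5) ^ dim W * r powr (0 - real (dim W))"
    by (rule \<U>(3))
  also have "\<dots> \<le> real (4 * ?d + 9) ^ ?d * r powr (0 - real (dim W))"
  proof (rule mult_right_mono)
    have "(4 * (real (dim W) + 1) * 1 + 5) ^ dim W \<le> real (4 * ?d + 9) ^ dim W"
      using dimW by (intro power_mono) auto
    also have "\<dots> \<le> real (4 * ?d + 9) ^ ?d"
      using dimW by (intro power_increasing) auto
    finally show "(4 * (real (dim W) + 1) * 1 + 5) ^ dim W \<le> real (4 * ?d + 9) ^ ?d" .
  qed simp
  finally have card: "real (card \<U>) \<le> real (4 * ?d + 9) ^ ?d * r powr (- real (dim W))" by simp
  define c where "c U = (SOME x. x \<in> U)" for U :: "'a set"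
  have c: "c U \<in> U" if "U \<in> \<U>" for U using U(3)[OF that] by (simp add: c_def some_in_eq)
  have "?S \<subseteq> (\<Union>U\<in>\<U>. cball (c U) (2 * r))"
  proof
    fix y assume y: "y \<in> ?S"
    let ?w = "y - orth_proj V y"
    have "?w \<in> W"
      using orth_proj_orthogonal[OF V, of _ y] by (auto simp: W_def orthogonal_commute)
    moreover have "norm ?w \<le> 1"
      using norm_diff_orth_proj_le[OF V, of y] y by simp
    ultimately obtain U where UU: "U \<in> \<U>" "?w \<in> U"
      using \<U>(2) by (auto simp: admissible_cover_def subset_iff)
    have "dist (c U) y \<le> dist (c U) ?w + dist ?w y" by (rule dist_triangle)
    also have "dist (c U) ?w \<le> r"
      using diameter_bounded_bound[OF U(1) c UU(2)] U(2) UU(1) by simp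
    also have "dist ?w y \<le> r" using y by (simp add: dist_norm)
    finally show "y \<in> (\<Union>U\<in>\<U>. cball (c U) (2 * r))" using UU by auto
  qed
  then have "measure lebesgue ?S \<le> measure lebesgue (\<Union>U\<in>\<U>. cball (c U) (2 * r))"
    using cS \<U>(1) by (intro measure_mono_fmeasurable)
      (auto intro!: fmeasurableD lmeasurable_compact compact_UN)
  also have "\<dots> \<le> (\<Sum>U\<in>\<U>. measure lebesgue (cball (c U) (2 * r)))"
    using \<U>(1) by (intro measure_UNION_le) auto
  also have "\<dots> = real (card \<U>) * ((2 * r) ^ ?d * measure lebesgue (cball (0::'a) 1))"
    using r by (simp add: measure_completion content_cball mult_ac)
  also have "\<dots> \<le> (real (4 * ?d + 9) ^ ?d * r powr (- real (dim W))) * ((2 * r) ^ ?d * measure lebesgue (cball (0::'a) 1))"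
    using card r by (intro mult_right_mono) auto
  also have "\<dots> = real (8 * ?d + 18) ^ ?d * measure lebesgue (cball (0::'a) 1) * (r ^ ?d * r powr (- real (dim W)))"
  proof -
    have "real (8 * ?d + 18) = real (4 * ?d + 9) * 2" by simp
    then have "real (8 * ?d + 18) ^ ?d = real (4 * ?d + 9) ^ ?d * 2 ^ ?d"
      by (simp only: power_mult_distrib)
    then show ?thesis by (simp only: power_mult_distrib mult_ac)
  qed
  also have "r ^ ?d * r powr (- real (dim W)) = r ^ dim V"
    using r by (simp add: powr_minus powr_realpow power_add field_simps flip: dimW)
  finally show "measure lebesgue ?S
      \<le> real (8 * ?d + 18) ^ ?d * measure lebesgue (cball (0::'a) 1) * r ^ dim V" .
qed

text \<open>
  Rotations act transitively on spheres, except on the line, where the only rotation is the identity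
  and \<open>x = - y\<close> has to be treated by hand.
\<close>

lemma emeasure_small_projection_norm_cong:
  fixes x y :: "real ^ 'n"
  assumes \<gamma>: "grassmannian_haar m \<gamma>" and eq: "norm x = norm y"
  shows "emeasure \<gamma> {V \<in> space \<gamma>. norm (orth_proj V x) \<le> r}
    = emeasure \<gamma> {V \<in> space \<gamma>. norm (orth_proj V y) \<le> r}"
proof (cases "2 \<le> CARD('n)")
  case True
  obtain g where g: "orthogonal_transformation g" "det (matrix g) = 1" "g x = y"
    using rotation_exists[OF True eq] by blast
  let ?A = "\<lambda>x. {V \<in> space \<gamma>. norm (orth_proj V x) \<le> r}"
  have [simp]: "space \<gamma> = grassmannian m" using \<gamma> by (rule space_grassmannian_haar)
  have [measurable]: "(\<lambda>V. orth_proj V x) \<in> borel_measurable \<gamma>"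
    using \<gamma> by (rule measurable_orth_proj)
  have A: "?A x \<in> sets \<gamma>" by measurable
  obtain g' where g': "orthogonal_transformation g'" "g \<circ> g' = id" "g' \<circ> g = id"
    using g(1) by (metis orthogonal_transformation_inv orthogonal_transformation_surj
        orthogonal_transformation_inj surj_iff inj_iff)
  have sub: "h ` V \<in> grassmannian m" if "orthogonal_transformation h" "V \<in> grassmannian m" for h V
    using that orthogonal_transformation_linear[of h] orthogonal_transformation_inj[of h]
    by (auto simp: grassmannian_def linear_subspace_image dim_image_eq inj_on_subset)
  have "(`) g ` ?A x = ?A y"
  proof (intro equalityI subsetI)
    fix W assume "W \<in> (`) g ` ?A x"
    then show "W \<in> ?A y"
      using g sub orth_proj_orthogonal_image[OF _ g(1), of _ x]
      by (auto simp: grassmannian_def orthogonal_transformation_norm)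
  next
    fix W assume W: "W \<in> ?A y"
    have "W = g ` (g' ` W)" using g'(2) by (simp add: image_comp)
    moreover have "g' y = x" using g g'(3) by (metis comp_apply id_apply)
    then have "g' ` W \<in> ?A x"
      using W sub[OF g'(1)] orth_proj_orthogonal_image[OF _ g'(1), of W y] g'(1)
      by (auto simp: grassmannian_def orthogonal_transformation_norm)
    ultimately show "W \<in> (`) g ` ?A x" by blast
  qed
  moreover have "emeasure \<gamma> ((`) g ` ?A x) = emeasure \<gamma> (?A x)"
    using \<gamma> g(1,2) A by (simp add: grassmannian_haar_def)
  ultimately show ?thesis by simp
next
  case False
  then have "CARD('n) = 1" using one_le_card_finite[where 'a='n] by linarith
  then obtain i :: 'n where UNIV: "UNIV = {i}" using card_1_singletonE by blast
  have "norm z = \<bar>z $ i\<bar>" for z :: "real ^ 'n"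
    unfolding norm_vec_def L2_set_def UNIV by simp
  then have "\<bar>x $ i\<bar> = \<bar>y $ i\<bar>" using eq by simp
  then have "x = y \<or> x = - y"
    using UNIV by (auto simp: vec_eq_iff abs_eq_iff)
  moreover have "norm (orth_proj V (- y)) = norm (orth_proj V y)" if "V \<in> space \<gamma>" for V
    using that space_grassmannian_haar[OF \<gamma>]
    by (simp add: grassmannian_def linear_orth_proj linear_neg)
  ultimately show ?thesis by (metis (mono_tags, lifting) Collect_cong)
qed

text \<open>
  By rotation invariance the left-hand side depends only on \<open>r / norm x\<close>, so it may be averaged over
  all directions, that is, over \<open>x\<close> in the unit ball. Exchanging the order of integration reduces the
  claim to the volume of a slab for each fixed \<open>V\<close>.
\<close>

lemma measure_small_projection_le:
  fixes x :: "real ^ 'n"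
  assumes \<gamma>: "grassmannian_haar m \<gamma>" and x: "x \<noteq> 0" and r: "0 < r"
  shows "measure \<gamma> {V \<in> space \<gamma>. norm (orth_proj V x) \<le> r}
    \<le> real (8 * CARD('n) + 18) ^ CARD('n) * (r / norm x) ^ m"
proof (cases "r \<le> norm x")
  case False
  interpret prob_space \<gamma> using \<gamma> by (simp add: grassmannian_haar_def)
  have "1 * 1 \<le> real (8 * CARD('n) + 18) ^ CARD('n) * (r / norm x) ^ m"
    using False x by (intro mult_mono one_le_power) auto
  then show ?thesis by (intro order_trans[OF prob_le_1]) simp
next
  case True
  interpret prob_space \<gamma> using \<gamma> by (simp add: grassmannian_haar_def)
  interpret P: pair_sigma_finite \<gamma> "lborel :: (real ^ 'n) measure" ..
  have sp: "space \<gamma> = grassmannian m" using \<gamma> by (rule space_grassmannian_haar)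
  note [measurable] = measurable_orth_proj[OF \<gamma>]
  define t where "t = r / norm x"
  have t: "0 < t" "t \<le> 1" using r x True by (auto simp: t_def)
  let ?B = "cball (0 :: real ^ 'n) 1" and ?K = "real (8 * CARD('n) + 18) ^ CARD('n)"
  let ?A = "\<lambda>y s. {V \<in> space \<gamma>. norm (orth_proj V y) \<le> s}"
  \<comment> \<open>Expanding \<open>y\<close> in the standard basis makes joint measurability in \<open>(V, y)\<close> evident.\<close>
  define Z where "Z = {z \<in> space (\<gamma> \<Otimes>\<^sub>M (lborel :: (real ^ 'n) measure)).
     norm (snd z) \<le> 1 \<and> norm (\<Sum>b\<in>Basis. (snd z \<bullet> b) *\<^sub>R orth_proj (fst z) b) \<le> t}"
  have [measurable]: "(\<lambda>z. orth_proj (fst z) b) \<in> borel_measurable (\<gamma> \<Otimes>\<^sub>M (lborel :: (real ^ 'n) measure))"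
    for b :: "real ^ 'n"
    by (rule measurable_compose[OF measurable_fst measurable_orth_proj[OF \<gamma>]])
  have Z[measurable]: "Z \<in> sets (\<gamma> \<Otimes>\<^sub>M lborel)" unfolding Z_def by measurable
  have expand: "(\<Sum>b\<in>Basis. (y \<bullet> b) *\<^sub>R orth_proj V b) = orth_proj V y" if "V \<in> space \<gamma>" for V y
  proof -
    have lin: "linear (orth_proj V)" using that sp by (simp add: grassmannian_def linear_orth_proj)
    show ?thesis
      using linear_sum[OF lin, of "\<lambda>b. (y \<bullet> b) *\<^sub>R b" Basis]
      by (simp add: linear_scale[OF lin] euclidean_representation)
  qed
  have "emeasure \<gamma> (?A x r) * emeasure lborel ?B = (\<integral>\<^sup>+y. emeasure \<gamma> (?A x r) * indicator ?B y \<partial>lborel)"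
    by (simp add: nn_integral_cmult_indicator)
  also have "\<dots> \<le> (\<integral>\<^sup>+y. emeasure \<gamma> ((\<lambda>V. (V, y)) -` Z) \<partial>lborel)"
  proof (rule nn_integral_mono)
    fix y :: "real ^ 'n"
    show "emeasure \<gamma> (?A x r) * indicator ?B y \<le> emeasure \<gamma> ((\<lambda>V. (V, y)) -` Z)"
    proof (cases "y \<in> ?B")
      case True
      let ?y = "(norm y / norm x) *\<^sub>R x"
      have "norm (orth_proj V ?y) \<le> t" if V: "V \<in> ?A x r" for V
      proof -
        have "norm (orth_proj V ?y) = norm y / norm x * norm (orth_proj V x)"
          using V sp by (simp add: grassmannian_def linear_orth_proj linear_scale)
        also have "\<dots> \<le> 1 / norm x * r"
          using V True r by (intro mult_mono divide_right_mono) auto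
        finally show ?thesis by (simp add: t_def)
      qed
      then have "emeasure \<gamma> (?A x r) \<le> emeasure \<gamma> (?A ?y t)"
        by (intro emeasure_mono) (auto, measurable)
      also have "\<dots> = emeasure \<gamma> (?A y t)"
        using x by (intro emeasure_small_projection_norm_cong[OF \<gamma>]) simp
      also have "?A y t = (\<lambda>V. (V, y)) -` Z"
        using True expand by (auto simp: Z_def space_pair_measure)
      finally show ?thesis using True by simp
    qed auto
  qed
  also have "\<dots> = (\<integral>\<^sup>+V. emeasure lborel (Pair V -` Z) \<partial>\<gamma>)"
    using P.emeasure_pair_measure_alt2[OF Z] lborel.emeasure_pair_measure_alt[OF Z] by simp
  also have "\<dots> \<le> (\<integral>\<^sup>+V. ennreal (?K * measure lebesgue ?B * t ^ m) \<partial>\<gamma>)"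
  proof (rule nn_integral_mono)
    fix V assume V: "V \<in> space \<gamma>"
    then have sub: "subspace V" "dim V = m" using sp by (auto simp: grassmannian_def)
    let ?S = "{y \<in> ?B. norm (orth_proj V y) \<le> t}"
    have cS: "compact ?S" by (rule measure_ball_slab_le(2)[OF sub(1) t])
    have "Pair V -` Z = ?S" using V expand by (auto simp: Z_def space_pair_measure)
    moreover have "emeasure lborel ?S = ennreal (measure lborel ?S)"
      using emeasure_bounded_finite[OF compact_imp_bounded[OF cS]] by (simp add: emeasure_eq_ennreal_measure less_top)
    moreover have "measure lborel ?S = measure lebesgue ?S"
      using cS by (simp add: measure_completion borel_compact)
    ultimately have "emeasure lborel (Pair V -` Z) = ennreal (measure lebesgue ?S)" by (simp only:)
    also have "\<dots> \<le> ennreal (?K * measure lebesgue ?B * t ^ m)"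
      by (rule ennreal_leI) (rule measure_ball_slab_le(1)[OF sub(1) t, unfolded sub(2) DIM_cart DIM_real mult_1_right])
    finally show "emeasure lborel (Pair V -` Z) \<le> ennreal (?K * measure lebesgue ?B * t ^ m)" .
  qed
  also have "\<dots> = ennreal (?K * measure lebesgue ?B * t ^ m)" by (simp add: emeasure_space_1)
  finally have "emeasure \<gamma> (?A x r) * emeasure lborel ?B \<le> ennreal (?K * measure lebesgue ?B * t ^ m)" .
  moreover have "emeasure lborel ?B = ennreal (measure lebesgue ?B)"
    using emeasure_bounded_finite[of ?B] by (simp add: emeasure_eq_ennreal_measure less_top measure_completion)
  moreover have "emeasure \<gamma> (?A x r) = ennreal (measure \<gamma> (?A x r))"
    by (rule emeasure_eq_measure)
  ultimately have "ennreal (measure \<gamma> (?A x r) * measure lebesgue ?B) \<le> ennreal (?K * measure lebesgue ?B * t ^ m)"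
    by (simp only: ennreal_mult'' measure_nonneg)
  then have "measure \<gamma> (?A x r) * measure lebesgue ?B \<le> ?K * measure lebesgue ?B * t ^ m"
    using t by (subst (asm) ennreal_le_iff) (auto intro!: mult_nonneg_nonneg)
  then have "measure \<gamma> (?A x r) * measure lebesgue ?B \<le> (?K * t ^ m) * measure lebesgue ?B"
    by (simp only: mult_ac)
  moreover have "0 < measure lebesgue ?B" by (simp add: content_cball_pos)
  ultimately show ?thesis
    unfolding t_def by (rule mult_right_le_imp_le)
qed

section \<open>Discrete Frostman measures\<close>

text \<open>
  Points are treated one after the other; each receives the largest weight that violates no
  capacity \<open>c i\<close>. Then some set containing it is full, and stays full afterwards.
\<close>

lemma greedy_saturating_weights:
  fixes B :: "'i \<Rightarrow> 'a set" and c :: "'i \<Rightarrow> real"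
  assumes "finite X" "finite I" "\<And>i. i \<in> I \<Longrightarrow> 0 \<le> c i"
    and "\<And>x. x \<in> X \<Longrightarrow> \<exists>i\<in>I. x \<in> B i"
  obtains w :: "'a \<Rightarrow> real" where "\<And>x. 0 \<le> w x" "\<And>i. i \<in> I \<Longrightarrow> sum w (X \<inter> B i) \<le> c i"
    "\<And>x. x \<in> X \<Longrightarrow> \<exists>i\<in>I. x \<in> B i \<and> sum w (X \<inter> B i) = c i"
proof -
  have "\<exists>w. (\<forall>x. 0 \<le> w x) \<and> (\<forall>i\<in>I. sum w (X \<inter> B i) \<le> c i) \<and>
      (\<forall>x\<in>X. \<exists>i\<in>I. x \<in> B i \<and> sum w (X \<inter> B i) = c i)"
    using assms(1,4)
  proof (induction X rule: finite_induct)
    case empty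
    then show ?case using assms(3) by (intro exI[of _ "\<lambda>_. 0"]) auto
  next
    case (insert x X)
    then obtain w where w: "\<And>y. 0 \<le> w y" "\<And>i. i \<in> I \<Longrightarrow> sum w (X \<inter> B i) \<le> c i"
        "\<And>y. y \<in> X \<Longrightarrow> \<exists>i\<in>I. y \<in> B i \<and> sum w (X \<inter> B i) = c i"
      by (metis insert_iff)
    define J where "J = {i \<in> I. x \<in> B i}"
    have J: "finite J" "J \<noteq> {}" using assms(2) insert.prems by (auto simp: J_def)
    define t where "t = Min ((\<lambda>i. c i - sum w (X \<inter> B i)) ` J)"
    have t_le: "t \<le> c i - sum w (X \<inter> B i)" if "i \<in> J" for i
      using J that by (simp add: t_def)
    have "t \<in> (\<lambda>i. c i - sum w (X \<inter> B i)) ` J"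
      unfolding t_def using J by (intro Min_in) auto
    then obtain k where k: "k \<in> J" "t = c k - sum w (X \<inter> B k)" by blast
    then have t0: "0 \<le> t" using w(2) by (simp add: J_def)
    have upd: "sum (w(x := t)) (insert x X \<inter> B i) = sum w (X \<inter> B i) + (if x \<in> B i then t else 0)" for i
    proof -
      have "sum (w(x := t)) (X \<inter> B i) = sum w (X \<inter> B i)"
        using insert.hyps by (intro sum.cong) auto
      then show ?thesis using insert.hyps by (auto simp: Int_insert_left)
    qed
    show ?case
    proof (intro exI[of _ "w(x := t)"] conjI allI ballI)
      show "0 \<le> (w(x := t)) y" for y using w(1) t0 by simp
      fix i assume i: "i \<in> I"
      show "sum (w(x := t)) (insert x X \<inter> B i) \<le> c i"
        using i t_le[of i] w(2)[OF i] unfolding upd by (auto simp: J_def)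
    next
      fix y assume y: "y \<in> insert x X"
      show "\<exists>i\<in>I. y \<in> B i \<and> sum (w(x := t)) (insert x X \<inter> B i) = c i"
      proof (cases "y = x")
        case True
        then show ?thesis using k unfolding upd by (intro bexI[of _ k]) (auto simp: J_def)
      next
        case False
        then obtain i where i: "i \<in> I" "y \<in> B i" "sum w (X \<inter> B i) = c i"
          using y w(3) by auto
        have "x \<in> B i \<Longrightarrow> t = 0"
          using t_le[of i] i t0 by (simp add: J_def)
        then show ?thesis using i unfolding upd by (intro bexI[of _ i]) auto
      qed
    qed
  qed
  then show thesis using that by blast
qed

text \<open>
  Take a finite \<open>\<rho>\<close>-net \<open>X\<close> of \<open>E\<close> and greedy weights whose capacities are the powers \<open>r powr s\<close> of the
  radii of balls centred in \<open>X\<close>. The saturated balls cover \<open>X\<close>; a disjoint subfamily, enlarged by a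
  bounded factor, covers \<open>E\<close>. Its sum of powers of diameters is comparable to the mass of disjoint
  saturated balls and thus at most to the total weight, which is therefore bounded below when \<open>E\<close>
  has no cheap cover. Normalising the total weight to \<open>1\<close> gives the claim.
\<close>

lemma discrete_Frostman:
  fixes E :: "'a::euclidean_space set"
  assumes E: "compact E" and \<rho>: "0 < \<rho>" "\<delta> powr (1/\<theta>) \<le> 12 * \<rho>" "12 * (2 ^ L * \<rho>) \<le> \<delta>"
    and \<epsilon>: "0 < \<epsilon>" and no: "\<not> has_cover \<theta> \<delta> s \<epsilon> E"
  obtains X w where "finite X" "X \<subseteq> E" "\<And>x. 0 \<le> w x" "sum w X = (1 :: real)"
    "\<And>x l. \<lbrakk>x \<in> X; l \<le> L\<rbrakk> \<Longrightarrow> sum w (X \<inter> ball x (2 ^ l * \<rho>)) \<le> 12 powr s / \<epsilon> * (2 ^ l * \<rho>) powr s"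
proof -
  have "E \<subseteq> (\<Union>x\<in>E. ball x \<rho>)" using \<rho> by auto
  then obtain X where X: "X \<subseteq> E" "finite X" "E \<subseteq> (\<Union>x\<in>X. ball x \<rho>)"
    using compactE_image[OF E, of E "\<lambda>x. ball x \<rho>"] by auto
  define I where "I = X \<times> {..L}"
  define r where "r i = 2 ^ snd i * \<rho>" for i :: "'a \<times> nat"
  define B where "B i = ball (fst i) (r i)" for i
  have r: "\<rho> \<le> r i" "r i \<le> 2 ^ L * \<rho>" if "i \<in> I" for i
    using that \<rho>(1) by (auto simp: r_def I_def)
  have fI: "finite I" using X by (simp add: I_def)
  have "\<exists>i\<in>I. x \<in> B i" if "x \<in> X" for x
    using that \<rho> by (intro bexI[of _ "(x, 0)"]) (auto simp: I_def B_def r_def)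
  then obtain w where w: "\<And>x. 0 \<le> w x" "\<And>i. i \<in> I \<Longrightarrow> sum w (X \<inter> B i) \<le> r i powr s"
    "\<And>x. x \<in> X \<Longrightarrow> \<exists>i\<in>I. x \<in> B i \<and> sum w (X \<inter> B i) = r i powr s"
    using greedy_saturating_weights[of X I "\<lambda>i. r i powr s" B] X(2) fI by (metis powr_ge_zero)
  define K where "K = {i \<in> I. sum w (X \<inter> B i) = r i powr s}"
  have cov: "X \<subseteq> (\<Union>i\<in>K. ball (fst i) (r i))" using w(3) unfolding K_def B_def by blast
  have rK: "0 < r i \<and> r i \<le> 2 ^ L * \<rho>" if "i \<in> K" for i
    using that r[of i] \<rho>(1) by (auto simp: K_def)
  obtain C where C: "C \<subseteq> K"
      "pairwise (\<lambda>i j. disjnt (ball (fst i) (r i)) (ball (fst j) (r j))) C"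
      "X \<subseteq> (\<Union>i\<in>C. ball (fst i) (5 * r i))"
    by (rule Vitali_covering_lemma_balls[OF cov rK]) (assumption | rule that)+
  have CI: "C \<subseteq> I" using C(1) by (auto simp: K_def)
  have fC: "finite C" using CI fI by (rule finite_subset)
  \<comment> \<open>The covering lemma costs the factor 5; one more radius passes from the net \<open>X\<close> to \<open>E\<close>.\<close>
  define \<U> where "\<U> = (\<lambda>i. ball (fst i) (6 * r i)) ` C"
  have adm: "admissible_cover \<theta> \<delta> E \<U>"
    unfolding admissible_cover_def
  proof (intro conjI ballI)
    show "E \<subseteq> \<Union>\<U>"
    proof
      fix y assume "y \<in> E"
      then obtain x where x: "x \<in> X" "dist x y < \<rho>" using X(3) by auto
      then obtain i where i: "i \<in> C" "dist (fst i) x < 5 * r i" using C(3) by auto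
      have "dist (fst i) y \<le> dist (fst i) x + dist x y" by (rule dist_triangle)
      also have "\<dots> < 6 * r i" using x i r[of i] CI by auto
      finally show "y \<in> \<Union>\<U>" using i(1) by (auto simp: \<U>_def)
    qed
    fix U assume "U \<in> \<U>"
    then obtain i where i: "i \<in> I" "U = ball (fst i) (6 * r i)" using CI by (auto simp: \<U>_def)
    then show "bounded U" "\<delta> powr (1/\<theta>) \<le> diameter U" "diameter U \<le> \<delta>"
      using r[of i] \<rho> by auto
  qed
  have "(\<Sum>U\<in>\<U>. diameter U powr s) \<le> (\<Sum>i\<in>C. (12 * r i) powr s)"
  proof -
    have "(\<Sum>U\<in>\<U>. diameter U powr s) \<le> (\<Sum>i\<in>C. diameter (ball (fst i) (6 * r i)) powr s)"
      using sum_image_le[OF fC, of "\<lambda>U. diameter U powr s" "\<lambda>i. ball (fst i) (6 * r i)"]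
      by (simp add: o_def \<U>_def)
    also have "\<dots> = (\<Sum>i\<in>C. (12 * r i) powr s)"
      using CI r(1) \<rho>(1) by (intro sum.cong) (auto simp: subset_iff, fastforce)
    finally show ?thesis .
  qed
  also have "\<dots> = 12 powr s * (\<Sum>i\<in>C. sum w (X \<inter> B i))"
  proof -
    have "(12 * r i) powr s = 12 powr s * sum w (X \<inter> B i)" if "i \<in> C" for i
    proof -
      have "i \<in> K" using that C(1) by blast
      then have "sum w (X \<inter> B i) = r i powr s" by (simp add: K_def)
      moreover have "0 \<le> r i" using rK[OF \<open>i \<in> K\<close>] by simp
      ultimately show ?thesis by (simp add: powr_mult)
    qed
    then show ?thesis by (simp add: sum_distrib_left)
  qed
  also have "(\<Sum>i\<in>C. sum w (X \<inter> B i)) = sum w (\<Union>i\<in>C. X \<inter> B i)"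
  proof (rule sum.UNION_disjoint[symmetric])
    show "\<forall>i\<in>C. \<forall>j\<in>C. i \<noteq> j \<longrightarrow> (X \<inter> B i) \<inter> (X \<inter> B j) = {}"
      using C(2) unfolding pairwise_def disjnt_def B_def by blast
  qed (use fC X(2) in auto)
  also have "\<dots> \<le> sum w X" using X(2) w(1) by (intro sum_mono2) auto
  finally have "(\<Sum>U\<in>\<U>. diameter U powr s) \<le> 12 powr s * sum w X" by simp
  moreover have "\<not> (\<Sum>U\<in>\<U>. diameter U powr s) \<le> \<epsilon>"
    using no has_coverI_finite[OF _ adm] fC by (auto simp: \<U>_def)
  ultimately have big: "\<epsilon> < 12 powr s * sum w X" by linarith
  then have W: "0 < sum w X" using \<epsilon> by (metis less_trans powr_gt_zero zero_less_mult_pos zero_neq_numeral)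
  show thesis
  proof (rule that[of X "\<lambda>x. w x / sum w X"])
    show "(\<Sum>x\<in>X. w x / sum w X) = 1" using W by (simp flip: sum_divide_distrib)
    fix x l assume xl: "x \<in> X" "l \<le> L"
    have "(\<Sum>z\<in>X \<inter> ball x (2 ^ l * \<rho>). w z / sum w X) = sum w (X \<inter> B (x, l)) / sum w X"
      by (simp add: B_def r_def sum_divide_distrib)
    also have "\<dots> \<le> r (x, l) powr s / sum w X"
      using xl W by (intro divide_right_mono w(2)) (auto simp: I_def)
    also have "\<dots> \<le> r (x, l) powr s * (12 powr s / \<epsilon>)"
    proof -
      have "1 / sum w X \<le> 12 powr s / \<epsilon>" using big W \<epsilon> by (simp add: field_simps)
      then have "r (x, l) powr s * (1 / sum w X) \<le> r (x, l) powr s * (12 powr s / \<epsilon>)"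
        by (rule mult_left_mono) simp
      then show ?thesis by simp
    qed
    finally show "(\<Sum>z\<in>X \<inter> ball x (2 ^ l * \<rho>). w z / sum w X) \<le> 12 powr s / \<epsilon> * (2 ^ l * \<rho>) powr s"
      by (simp add: r_def mult.commute)
  qed (use X w(1) W in auto)
qed

text \<open>
  Writing \<open>\<nu> y\<close> for the weight of the fibre over \<open>y\<close>, this is the inequality of Cauchy and Schwarz for
  \<open>\<Sum>y. sqrt (D y) * (\<nu> y / sqrt (D y))\<close>. In the application the fibres arise from the members of a
  cover, and the double sum is dominated by an energy.
\<close>

lemma Cauchy_Schwarz_fibres:
  fixes w :: "'a \<Rightarrow> real" and D :: "'b \<Rightarrow> real"
  assumes fin: "finite X" "finite Y" and f: "f ` X \<subseteq> Y" and D: "\<And>y. y \<in> Y \<Longrightarrow> 0 < D y"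
  shows "(sum w X)\<^sup>2 \<le> sum D Y * (\<Sum>x\<in>X. \<Sum>z\<in>X. if f x = f z then w x * w z / D (f x) else 0)"
proof -
  define \<nu> where "\<nu> y = (\<Sum>x\<in>X. if f x = y then w x else 0)" for y
  have "sum w X = (\<Sum>x\<in>X. \<Sum>y\<in>Y. if f x = y then w x else 0)"
    using f fin by (intro sum.cong) (auto simp: subset_iff)
  also have "\<dots> = sum \<nu> Y" unfolding \<nu>_def by (rule sum.swap)
  also have "\<dots> = (\<Sum>y\<in>Y. sqrt (D y) * (\<nu> y / sqrt (D y)))"
    using D by (intro sum.cong) (auto simp: less_imp_neq[symmetric] order_less_imp_not_eq2)
  also have "(\<dots>)\<^sup>2 \<le> (\<Sum>y\<in>Y. (sqrt (D y))\<^sup>2) * (\<Sum>y\<in>Y. (\<nu> y / sqrt (D y))\<^sup>2)"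
    by (rule Cauchy_Schwarz_ineq_sum)
  also have "(\<Sum>y\<in>Y. (sqrt (D y))\<^sup>2) = sum D Y"
    using D by (intro sum.cong) (auto simp: less_imp_le)
  also have "(\<Sum>y\<in>Y. (\<nu> y / sqrt (D y))\<^sup>2)
      = (\<Sum>y\<in>Y. \<Sum>x\<in>X. \<Sum>z\<in>X. if y = f x then if f x = f z then w x * w z / D (f x) else 0 else 0)"
  proof (intro sum.cong refl)
    fix y assume y: "y \<in> Y"
    have "(\<nu> y / sqrt (D y))\<^sup>2 = \<nu> y * \<nu> y / D y"
      using D[OF y] by (simp add: power_divide power2_eq_square)
    also have "\<dots> = (\<Sum>x\<in>X. \<Sum>z\<in>X. (if f x = y then w x else 0) * (if f z = y then w z else 0) / D y)"
      unfolding \<nu>_def by (simp only: sum_product sum_divide_distrib)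
    also have "\<dots> = (\<Sum>x\<in>X. \<Sum>z\<in>X. if y = f x then if f x = f z then w x * w z / D (f x) else 0 else 0)"
      by (intro sum.cong) auto
    finally show "(\<nu> y / sqrt (D y))\<^sup>2 = \<dots>" .
  qed
  also have "\<dots> = (\<Sum>x\<in>X. \<Sum>y\<in>Y. \<Sum>z\<in>X. if y = f x then if f x = f z then w x * w z / D (f x) else 0 else 0)"
    by (rule sum.swap)
  also have "\<dots> = (\<Sum>x\<in>X. \<Sum>z\<in>X. \<Sum>y\<in>Y. if y = f x then if f x = f z then w x * w z / D (f x) else 0 else 0)"
    by (intro sum.cong refl sum.swap)
  also have "\<dots> = (\<Sum>x\<in>X. \<Sum>z\<in>X. if f x = f z then w x * w z / D (f x) else 0)"
    using f fin by (intro sum.cong refl) (auto simp: subset_iff)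
  finally show ?thesis .
qed

lemma dyadic_multiple_just_below:
  fixes \<rho> a :: real
  assumes "0 < \<rho>" "\<rho> \<le> a"
  obtains k where "2 ^ k * \<rho> \<le> a" "a < 2 * (2 ^ k * \<rho>)"
proof -
  obtain n where n: "a / \<rho> < 2 ^ n" using real_arch_pow[of 2 "a / \<rho>"] by auto
  define k where "k = (LEAST k. a < 2 ^ Suc k * \<rho>)"
  have ex: "a < 2 ^ Suc n * \<rho>"
  proof -
    have "a < 2 ^ n * \<rho>" using n assms by (simp add: field_simps)
    also have "\<dots> \<le> 2 ^ Suc n * \<rho>" using assms by (intro mult_right_mono) auto
    finally show ?thesis .
  qed
  then have "a < 2 ^ Suc k * \<rho>" unfolding k_def by (rule LeastI)
  moreover have "2 ^ k * \<rho> \<le> a"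
  proof (cases k)
    case 0
    then show ?thesis using assms by simp
  next
    case (Suc j)
    then have "\<not> a < 2 ^ Suc j * \<rho>" unfolding k_def using not_less_Least lessI by metis
    then show ?thesis using Suc by simp
  qed
  ultimately show thesis using that[of k] by simp
qed

text \<open>
  Decomposition into dyadic annuli between the radii \<open>2 ^ j * \<rho>\<close> and \<open>2 ^ L * \<rho>\<close>. The number \<open>p\<close>
  stands for the proportion of subspaces that bring two points at distance \<open>d\<close> within
  \<open>2 ^ j * \<rho>\<close> of each other; the last summand accounts for distances beyond the largest radius.
\<close>

lemma dyadic_kernel_bound:
  fixes \<rho> K p d :: real
  assumes \<rho>: "0 < \<rho>" and K: "1 \<le> K" and j: "j \<le> L"
    and p1: "p \<le> 1" and p: "0 < d \<Longrightarrow> p \<le> K * (2 ^ j * \<rho> / d) ^ m"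
  shows "p \<le> K * 2 ^ m * ((\<Sum>i\<le>L - j. (1 / 2 ^ m) ^ i * of_bool (d < 2 ^ (j + i) * \<rho>))
    + (2 ^ j * \<rho> / (2 ^ L * \<rho>)) ^ m)"
proof -
  let ?S = "\<Sum>i\<le>L - j. (1 / 2 ^ m) ^ i * of_bool (d < 2 ^ (j + i) * \<rho>) :: real"
  have S_ge: "(1 / 2 ^ m) ^ i * of_bool (d < 2 ^ (j + i) * \<rho>) \<le> ?S" if "i \<le> L - j" for i
    using that by (intro member_le_sum) auto
  have K0: "0 \<le> K * 2 ^ m" using K by simp
  have "K * 1 \<le> K * 2 ^ m" using K by (intro mult_left_mono) auto
  then have KM: "K \<le> K * 2 ^ m" by simp
  have S0: "0 \<le> ?S" by (intro sum_nonneg) auto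
  consider "d < 2 ^ j * \<rho>" | "2 ^ j * \<rho> \<le> d" "d < 2 ^ L * \<rho>" | "2 ^ L * \<rho> \<le> d" "2 ^ j * \<rho> \<le> d" 
  proof -
    have "2 ^ j * \<rho> \<le> 2 ^ L * \<rho>" using j \<rho> by (intro mult_right_mono) auto
    then show ?thesis using that by linarith
  qed
  then show ?thesis
  proof cases
    case 1
    have "1 * 1 * 1 \<le> K * 2 ^ m * (?S + (2 ^ j * \<rho> / (2 ^ L * \<rho>)) ^ m)"
      using K S_ge[of 0] 1 \<rho> by (intro mult_mono) (auto intro: add_increasing2)
    then show ?thesis using p1 by simp
  next
    case 2
    have "0 < 2 ^ j * \<rho>" using \<rho> by simp
    then obtain i where i: "2 ^ i * (2 ^ j * \<rho>) \<le> d" "d < 2 * (2 ^ i * (2 ^ j * \<rho>))"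
      using 2 dyadic_multiple_just_below[of "2 ^ j * \<rho>" d] by metis
    have "(2::real) ^ (i + j) * \<rho> < 2 ^ L * \<rho>" using i(1) 2 by (simp add: power_add mult_ac)
    then have "i + j < L" using \<rho> by simp
    then have iL: "Suc i \<le> L - j" by simp
    have d0: "0 < d" using 2 \<rho> by (smt (verit) zero_less_power mult_pos_pos)
    have "p \<le> K * (2 ^ j * \<rho> / d) ^ m" using p d0 .
    also have "\<dots> \<le> K * (1 / 2 ^ i) ^ m"
    proof -
      have "2 ^ j * \<rho> / d \<le> 1 / 2 ^ i" using i d0 by (simp add: field_simps)
      then show ?thesis using K \<rho> d0 by (intro mult_left_mono power_mono) auto
    qed
    also have "\<dots> = K * 2 ^ m * (1 / 2 ^ m) ^ Suc i"
      by (simp add: field_simps flip: power_mult)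
    also have "\<dots> \<le> K * 2 ^ m * ?S"
      using S_ge[OF iL] i(2) K0 by (intro mult_left_mono) (auto simp: power_add mult_ac)
    also have "\<dots> \<le> K * 2 ^ m * (?S + (2 ^ j * \<rho> / (2 ^ L * \<rho>)) ^ m)"
      using K0 \<rho> by (intro mult_left_mono) auto
    finally show ?thesis .
  next
    case 3
    have d0: "0 < d" using 3 \<rho> by (smt (verit) zero_less_power mult_pos_pos)
    have "p \<le> K * (2 ^ j * \<rho> / d) ^ m" using p d0 .
    also have "\<dots> \<le> K * (2 ^ j * \<rho> / (2 ^ L * \<rho>)) ^ m"
      using K \<rho> d0 3 by (intro mult_left_mono power_mono divide_left_mono) auto
    also have "\<dots> \<le> K * 2 ^ m * (?S + (2 ^ j * \<rho> / (2 ^ L * \<rho>)) ^ m)"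
      using KM K S0 \<rho> by (intro mult_mono) auto
    finally show ?thesis .
  qed
qed

section \<open>Energies of projected measures\<close>

lemma powr_two_pow_mult:
  fixes \<rho> c :: real
  assumes "0 < \<rho>"
  shows "(2 ^ j * \<rho>) powr c = (2 powr c) ^ j * \<rho> powr c"
proof -
  have "(2 ^ j :: real) powr c = (2 powr c) ^ j"
    by (simp add: powr_powr mult.commute flip: powr_realpow)
  then show ?thesis using assms by (simp add: powr_mult)
qed

text \<open>
  Combining the kernel bound with the Frostman condition, the annulus of radius \<open>2 ^ i\<close> times the
  target scale contributes a multiple of \<open>2 powr (i * (s - m))\<close>. Since \<open>s < m\<close>, these contributions
  form a convergent geometric series.
\<close>

lemma expected_neighbour_mass:
  fixes X :: "(real ^ 'n) set"
  assumes \<gamma>: "grassmannian_haar m \<gamma>" and X: "finite X" "x \<in> X"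
    and w: "\<And>z. 0 \<le> w z" "sum w X = 1" and \<rho>: "0 < \<rho>" and j: "j \<le> L"
    and s: "s < real m" and A: "0 < A"
    and Frostman: "\<And>l. l \<le> L \<Longrightarrow> sum w (X \<inter> ball x (2 ^ l * \<rho>)) \<le> A * (2 ^ l * \<rho>) powr s"
  shows "(\<Sum>z\<in>X. w z * measure \<gamma> {V \<in> space \<gamma>. norm (orth_proj V (x - z)) \<le> 2 ^ j * \<rho>})
    \<le> real (8 * CARD('n) + 18) ^ CARD('n) * 2 ^ m *
      (A / (1 - 2 powr (s - m)) * (2 ^ j * \<rho>) powr s + (2 ^ j * \<rho> / (2 ^ L * \<rho>)) ^ m)"
proof -
  interpret prob_space \<gamma> using \<gamma> by (simp add: grassmannian_haar_def)
  define K where "K = real (8 * CARD('n) + 18) ^ CARD('n)"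
  have K: "1 \<le> K" unfolding K_def by (intro one_le_power) simp
  define r where "r = 2 ^ j * \<rho>"
  define q where "q = 2 powr (s - m)"
  define e where "e = (r / (2 ^ L * \<rho>)) ^ m"
  have r: "0 < r" using \<rho> by (simp add: r_def)
  have q: "0 < q" "q < 1" using s by (auto simp: q_def powr_less_one)
  let ?p = "\<lambda>z. measure \<gamma> {V \<in> space \<gamma>. norm (orth_proj V (x - z)) \<le> r}"
  let ?I = "\<lambda>i z. of_bool (dist x z < 2 ^ (j + i) * \<rho>) :: real"
  have p: "?p z \<le> K * 2 ^ m * ((\<Sum>i\<le>L - j. (1 / 2 ^ m) ^ i * ?I i z) + e)" for z
    unfolding r_def e_def
  proof (rule dyadic_kernel_bound[OF \<rho> K j])
    assume "0 < dist x z"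
    then show "measure \<gamma> {V \<in> space \<gamma>. norm (orth_proj V (x - z)) \<le> 2 ^ j * \<rho>} \<le> K * (2 ^ j * \<rho> / dist x z) ^ m"
      using measure_small_projection_le[OF \<gamma>, of "x - z" "2 ^ j * \<rho>"] \<rho> by (simp add: K_def dist_norm)
  qed auto
  have mass: "(\<Sum>z\<in>X. w z * ?I i z) = sum w (X \<inter> ball x (2 ^ (j + i) * \<rho>))" for i
  proof -
    have "(\<Sum>z\<in>X. w z * ?I i z) = (\<Sum>z\<in>X. if z \<in> ball x (2 ^ (j + i) * \<rho>) then w z else 0)"
      by (intro sum.cong) auto
    then show ?thesis using X(1) by (simp add: sum.inter_restrict)
  qed
  have term_le: "(1 / 2 ^ m) ^ i * sum w (X \<inter> ball x (2 ^ (j + i) * \<rho>)) \<le> A * r powr s * q ^ i"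
    if i: "i \<le> L - j" for i
  proof -
    have eq: "2 ^ (j + i) * \<rho> = 2 ^ i * r" by (simp add: r_def power_add mult_ac)
    have "(1 / 2 ^ m) ^ i * sum w (X \<inter> ball x (2 ^ (j + i) * \<rho>)) \<le> (1 / 2 ^ m) ^ i * (A * (2 ^ i * r) powr s)"
      unfolding eq[symmetric] using i j by (intro mult_left_mono Frostman) auto
    also have "(2 ^ i * r) powr s = (2 powr s) ^ i * r powr s" using r by (rule powr_two_pow_mult)
    also have "(1 / 2 ^ m) ^ i * (A * ((2 powr s) ^ i * r powr s)) = A * r powr s * (2 powr s / 2 ^ m) ^ i"
      by (simp add: power_divide field_simps)
    also have "2 powr s / 2 ^ m = q" by (simp add: q_def powr_diff powr_realpow)
    finally show ?thesis .
  qed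
  have "(\<Sum>z\<in>X. w z * ?p z) \<le> (\<Sum>z\<in>X. w z * (K * 2 ^ m * ((\<Sum>i\<le>L - j. (1 / 2 ^ m) ^ i * ?I i z) + e)))"
    using w(1) p by (intro sum_mono mult_left_mono)
  also have "\<dots> = K * 2 ^ m * ((\<Sum>z\<in>X. \<Sum>i\<le>L - j. (1 / 2 ^ m) ^ i * (w z * ?I i z)) + e * sum w X)"
    by (simp only: sum_distrib_left distrib_left sum.distrib mult_ac)
  also have "(\<Sum>z\<in>X. \<Sum>i\<le>L - j. (1 / 2 ^ m) ^ i * (w z * ?I i z))
      = (\<Sum>i\<le>L - j. (1 / 2 ^ m) ^ i * sum w (X \<inter> ball x (2 ^ (j + i) * \<rho>)))"
    by (subst sum.swap) (simp only: mass flip: sum_distrib_left)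
  also have "\<dots> \<le> (\<Sum>i\<le>L - j. A * r powr s * q ^ i)"
    using term_le by (intro sum_mono) auto
  also have "\<dots> = A * r powr s * (\<Sum>i\<le>L - j. q ^ i)" by (simp add: sum_distrib_left)
  also have "\<dots> \<le> A * r powr s * (1 / (1 - q))"
    using A q by (intro mult_left_mono) (auto simp: sum_gp0 divide_right_mono)
  finally show ?thesis
    using K w(2) by (simp add: K_def r_def q_def e_def)
qed

text \<open>
  This is the step that works for quasi-Hausdorff dimensions but not for a single \<open>\<theta>\<close>: pairs further
  apart than \<open>\<delta>\<close>, about which the Frostman condition is silent, become negligible at scales \<open>r\<close> below
  a high power of \<open>\<delta>\<close>. Indeed \<open>r powr (m - s) \<le> C * \<delta> powr (a * (m - s)) \<le> C * \<delta> ^ m\<close>.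
\<close>

lemma scale_ratio_bound:
  fixes r R \<delta> s :: real
  assumes r: "0 < r" "r \<le> 2 * \<delta> ^ a" and \<delta>: "0 < \<delta>" "\<delta> \<le> 1" and R: "\<delta> < 24 * R"
    and s: "0 \<le> s" "s < real m" and a: "real m \<le> real a * (real m - s)"
  shows "(r / R) ^ m \<le> 48 ^ m * r powr s"
proof -
  have R0: "0 < R" using \<delta> R by linarith
  have "r / R \<le> r / (\<delta> / 24)"
    using r R R0 \<delta> by (intro divide_left_mono) auto
  then have "(r / R) ^ m \<le> (24 * r / \<delta>) ^ m"
    using r R0 by (intro power_mono) (auto simp: field_simps)
  also have "\<dots> = 24 ^ m * (r powr s * r powr (m - s)) / \<delta> ^ m"
    using r by (simp add: power_divide power_mult_distrib powr_realpow flip: powr_add)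
  also have "\<dots> \<le> 24 ^ m * (r powr s * (2 ^ m * \<delta> ^ m)) / \<delta> ^ m"
  proof (intro divide_right_mono mult_left_mono)
    have "r powr (m - s) \<le> (2 * \<delta> ^ a) powr (m - s)"
      using r s by (intro powr_mono2) auto
    also have "\<dots> = 2 powr (m - s) * \<delta> powr (a * (m - s))"
      using \<delta> by (simp add: powr_mult powr_powr flip: powr_realpow)
    also have "\<dots> \<le> 2 powr (m - s) * \<delta> powr m"
      using a \<delta> by (intro mult_left_mono powr_mono') auto
    also have "\<dots> \<le> 2 powr m * \<delta> powr m" using s by (intro mult_right_mono powr_mono) auto
    also have "\<dots> = 2 ^ m * \<delta> ^ m" using \<delta> by (simp add: powr_realpow)
    finally show "r powr (m - s) \<le> 2 ^ m * \<delta> ^ m" .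
  qed (use \<delta> in auto)
  also have "\<dots> = 48 ^ m * r powr s"
    using \<delta> power_mult_distrib[of "24::real" 2 m] by simp
  finally show ?thesis .
qed

lemma sum_dyadic_scales_le:
  fixes \<rho> c D :: real
  assumes "0 < \<rho>" "0 < c" "2 ^ J * \<rho> \<le> 2 * D"
  shows "(\<Sum>j\<le>J. (2 ^ j * \<rho>) powr c) \<le> (2 powr c)\<^sup>2 / (2 powr c - 1) * D powr c"
proof -
  define b where "b = 2 powr c"
  have b: "1 < b" using assms by (simp add: b_def)
  have D: "0 < D"
  proof -
    have "0 < 2 ^ J * \<rho>" using assms by simp
    then show ?thesis using assms(3) by linarith
  qed
  have "(\<Sum>j\<le>J. (2 ^ j * \<rho>) powr c) = (\<Sum>j\<le>J. b ^ j) * \<rho> powr c"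
    using assms by (simp add: powr_two_pow_mult b_def sum_distrib_right)
  also have "(\<Sum>j\<le>J. b ^ j) = (b ^ Suc J - 1) / (b - 1)"
    using b by (simp add: sum_gp0 field_simps)
  also have "\<dots> \<le> b * b ^ J / (b - 1)" using b by (intro divide_right_mono) auto
  finally have "(\<Sum>j\<le>J. (2 ^ j * \<rho>) powr c) \<le> b * b ^ J / (b - 1) * \<rho> powr c"
    by (simp add: mult_right_mono)
  also have "\<dots> = b / (b - 1) * (2 ^ J * \<rho>) powr c"
    using assms by (simp add: powr_two_pow_mult b_def)
  also have "\<dots> \<le> b / (b - 1) * (2 * D) powr c"
    using assms b by (intro mult_left_mono powr_mono2) auto
  also have "\<dots> = b\<^sup>2 / (b - 1) * D powr c"
    using D by (simp add: powr_mult b_def power2_eq_square)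
  finally show ?thesis by (simp add: b_def)
qed

text \<open>
  Assign to each point a covering set containing its image. Two points with the same set \<open>U\<close> have
  images within \<open>diameter U\<close>, hence contribute to the energy at the dyadic scale just above it.
  Rounding the diameter up to that scale costs the factor \<open>2 powr u\<close>.
\<close>

lemma cover_sum_times_energy_ge_1:
  fixes f :: "'a \<Rightarrow> 'b::metric_space"
  assumes X: "finite X" "X \<subseteq> E" and w: "\<And>x. 0 \<le> w x" "sum w X = 1"
    and u: "0 \<le> u" and \<rho>: "0 < \<rho>" "\<rho> \<le> D powr (1 / \<theta>)" and D: "0 < D" "D < 2 ^ J * \<rho>"
    and hc: "has_cover \<theta> D u \<eta> (f ` E)" and \<eta>: "0 \<le> \<eta>"
  shows "1 \<le> 2 powr u * (\<Sum>j\<le>J. (2 ^ j * \<rho>) powr - u *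
      (\<Sum>x\<in>X. \<Sum>z\<in>X. w x * w z * of_bool (dist (f x) (f z) \<le> 2 ^ j * \<rho>))) * \<eta>"
proof -
  obtain \<U> where \<U>: "finite \<U>" "admissible_cover \<theta> D (f ` E) \<U>" "(\<Sum>U\<in>\<U>. diameter U powr u) \<le> \<eta>"
    using has_coverE_finite[OF hc D(1) u \<eta>] by blast
  have "\<exists>U\<in>\<U>. f x \<in> U" if "x \<in> X" for x
    using that X(2) \<U>(2) unfolding admissible_cover_def by blast
  then obtain h where h: "\<And>x. x \<in> X \<Longrightarrow> h x \<in> \<U> \<and> f x \<in> h x" by metis
  have diam: "\<rho> \<le> diameter U" "diameter U \<le> D" "bounded U" if "U \<in> \<U>" for U
    using that \<U>(2) \<rho>(2) by (auto simp: admissible_cover_def)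
  let ?c = "\<lambda>x z j. w x * w z * of_bool (dist (f x) (f z) \<le> 2 ^ j * \<rho>)"
  have key: "(if h x = h z then w x * w z / diameter (h x) powr u else 0)
      \<le> 2 powr u * (\<Sum>j\<le>J. (2 ^ j * \<rho>) powr - u * ?c x z j)" if xz: "x \<in> X" "z \<in> X" for x z
  proof (cases "h x = h z")
    case True
    let ?d = "diameter (h x)"
    note dd = diam[OF conjunct1[OF h[OF xz(1)]]]
    obtain k where k: "2 ^ k * \<rho> \<le> ?d" "?d < 2 * (2 ^ k * \<rho>)"
      using dyadic_multiple_just_below[OF \<rho>(1) dd(1)] .
    have "2 ^ k * \<rho> < 2 ^ J * \<rho>" using k(1) dd(2) D(2) by linarith
    then have kJ: "Suc k \<le> J" using \<rho>(1) by simp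
    have "dist (f x) (f z) \<le> ?d"
      using h xz True dd(3) by (intro diameter_bounded_bound) auto
    then have close: "dist (f x) (f z) \<le> 2 ^ Suc k * \<rho>" using k(2) by simp
    have d0: "0 < ?d" using dd(1) \<rho>(1) by linarith
    have "(2 ^ Suc k * \<rho>) powr u \<le> (2 * ?d) powr u"
      using k(1) \<rho>(1) u by (intro powr_mono2) auto
    also have "\<dots> = 2 powr u * ?d powr u" using d0 by (simp add: powr_mult)
    finally have "1 / ?d powr u \<le> 2 powr u * (2 ^ Suc k * \<rho>) powr - u"
      using d0 \<rho>(1) by (simp add: powr_minus field_simps)
    then have "w x * w z * (1 / ?d powr u) \<le> w x * w z * (2 powr u * (2 ^ Suc k * \<rho>) powr - u)"
      using w(1) by (intro mult_left_mono) auto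
    also have "\<dots> = 2 powr u * ((2 ^ Suc k * \<rho>) powr - u * ?c x z (Suc k))"
      using close by simp
    also have "\<dots> \<le> 2 powr u * (\<Sum>j\<le>J. (2 ^ j * \<rho>) powr - u * ?c x z j)"
      using kJ w(1) by (intro mult_left_mono member_le_sum) auto
    finally show ?thesis using True by simp
  qed (use w(1) in \<open>auto intro!: sum_nonneg mult_nonneg_nonneg\<close>)
  have "(sum w X)\<^sup>2 \<le> (\<Sum>U\<in>\<U>. diameter U powr u) *
      (\<Sum>x\<in>X. \<Sum>z\<in>X. if h x = h z then w x * w z / diameter (h x) powr u else 0)"
  proof (rule Cauchy_Schwarz_fibres[OF X(1) \<U>(1)])
    fix U assume "U \<in> \<U>"
    then show "0 < diameter U powr u" using diam(1) \<rho>(1) by fastforce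
  qed (use h in auto)
  also have "\<dots> \<le> \<eta> * (\<Sum>x\<in>X. \<Sum>z\<in>X. 2 powr u * (\<Sum>j\<le>J. (2 ^ j * \<rho>) powr - u * ?c x z j))"
    using \<U>(3) \<eta> key w(1) by (intro mult_mono sum_mono sum_nonneg) auto
  also have "(\<Sum>x\<in>X. \<Sum>z\<in>X. 2 powr u * (\<Sum>j\<le>J. (2 ^ j * \<rho>) powr - u * ?c x z j))
      = 2 powr u * (\<Sum>x\<in>X. \<Sum>z\<in>X. \<Sum>j\<le>J. (2 ^ j * \<rho>) powr - u * ?c x z j)"
    by (simp only: sum_distrib_left)
  also have "(\<Sum>x\<in>X. \<Sum>z\<in>X. \<Sum>j\<le>J. (2 ^ j * \<rho>) powr - u * ?c x z j)
      = (\<Sum>x\<in>X. \<Sum>j\<le>J. \<Sum>z\<in>X. (2 ^ j * \<rho>) powr - u * ?c x z j)"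
    by (intro sum.cong refl sum.swap)
  also have "\<dots> = (\<Sum>j\<le>J. \<Sum>x\<in>X. \<Sum>z\<in>X. (2 ^ j * \<rho>) powr - u * ?c x z j)"
    by (rule sum.swap)
  also have "\<dots> = (\<Sum>j\<le>J. (2 ^ j * \<rho>) powr - u * (\<Sum>x\<in>X. \<Sum>z\<in>X. ?c x z j))"
    by (simp only: sum_distrib_left)
  finally show ?thesis using w(2) by (simp add: mult_ac)
qed

section \<open>Almost every projection\<close>

text \<open>
  What matters is that the scale \<open>\<delta>\<close> does not enter. The denominators \<open>1 - 2 powr (s - m)\<close>
  and \<open>2 powr (s - u) - 1\<close> stem from geometric series and are positive because \<open>u < s < m\<close>.
\<close>

definition energy_constant :: "'n::finite itself \<Rightarrow> nat \<Rightarrow> real \<Rightarrow> real \<Rightarrow> real \<Rightarrow> real" where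
  "energy_constant _ m u s \<epsilon> = real (8 * CARD('n) + 18) ^ CARD('n) * 2 ^ m *
     (12 powr s / \<epsilon> / (1 - 2 powr (s - m)) + 48 ^ m) * ((2 powr (s - u))\<^sup>2 / (2 powr (s - u) - 1))"

text \<open>
  With \<open>\<rho> = \<delta> powr (a / \<theta>)\<close>, the Frostman weights control the radii from \<open>\<rho>\<close> to about \<open>\<delta>\<close>, while
  the covers of the projection use diameters from \<open>\<rho>\<close> to \<open>\<delta> ^ a\<close> only. So parameter \<open>\<theta> / a\<close> at scale
  \<open>\<delta>\<close> upstairs corresponds to parameter \<open>\<theta>\<close> at scale \<open>\<delta> ^ a\<close> downstairs. The function \<open>G\<close> is the
  energy of the projected weights, summed over the dyadic scales in the smaller range.
\<close>

lemma exists_energy_function: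
  fixes E :: "(real ^ 'n) set"
  assumes \<gamma>: "grassmannian_haar m \<gamma>" and E: "compact E"
    and us: "0 \<le> u" "u < s" "s < real m" and \<theta>: "0 < \<theta>" "\<theta> \<le> 1" and \<epsilon>: "0 < \<epsilon>"
    and a: "2 \<le> a" "real m \<le> real a * (real m - s)" and \<delta>: "0 < \<delta>" "\<delta> \<le> 1 / 48"
    and no: "\<not> has_cover (\<theta> / a) \<delta> s \<epsilon> E"
  shows "\<exists>G. G \<in> borel_measurable \<gamma> \<and> (\<forall>V. 0 \<le> G V) \<and>
    (\<integral>\<^sup>+V. ennreal (G V) \<partial>\<gamma>) \<le> ennreal (energy_constant TYPE('n) m u s \<epsilon> * (\<delta> ^ a) powr (s - u)) \<and>
    (\<forall>V\<in>space \<gamma>. \<forall>\<eta>\<ge>0. has_cover \<theta> (\<delta> ^ a) u \<eta> (orth_proj V ` E) \<longrightarrow> 1 \<le> 2 powr u * G V * \<eta>)"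
proof -
  interpret prob_space \<gamma> using \<gamma> by (simp add: grassmannian_haar_def)
  note [measurable] = measurable_orth_proj[OF \<gamma>]
  define A where "A = 12 powr s / \<epsilon>"
  have A: "0 < A" using \<epsilon> by (simp add: A_def)
  define D where "D = \<delta> ^ a"
  define \<rho> where "\<rho> = D powr (1 / \<theta>)"
  \<comment> \<open>The factor 48 leaves room for the scales just above \<open>D\<close>, up to \<open>2 * D\<close>, below the largest
    Frostman radius, which exceeds \<open>\<delta> / 24\<close>.\<close>
  have D: "0 < D" "D \<le> \<delta> / 48"
  proof -
    show "0 < D" using \<delta> by (simp add: D_def)
    have "D \<le> \<delta> ^ 2" unfolding D_def using \<delta> a by (intro power_decreasing) auto
    also have "\<dots> \<le> \<delta> / 48" using \<delta> by (simp add: power2_eq_square)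
    finally show "D \<le> \<delta> / 48" .
  qed
  have \<rho>: "0 < \<rho>" "\<rho> \<le> D"
    using D \<theta> \<delta> powr_mono'[of 1 "1/\<theta>" D] by (auto simp: \<rho>_def)
  have \<rho>_alt: "\<delta> powr (1 / (\<theta> / a)) = \<rho>"
  proof -
    have "1 / (\<theta> / a) = real a * (1 / \<theta>)" by simp
    then have "\<delta> powr (1 / (\<theta> / a)) = (\<delta> powr real a) powr (1 / \<theta>)" by (simp only: powr_powr)
    then show ?thesis using \<delta> by (simp add: \<rho>_def D_def powr_realpow)
  qed
  obtain L where L: "2 ^ L * \<rho> \<le> \<delta> / 12" "\<delta> / 12 < 2 * (2 ^ L * \<rho>)"
    using \<rho> D \<delta> by (elim dyadic_multiple_just_below[of \<rho> "\<delta> / 12", rotated 2]) auto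
  obtain J where J: "2 ^ J * \<rho> \<le> 2 * D" "2 * D < 2 * (2 ^ J * \<rho>)"
    using \<rho> D by (elim dyadic_multiple_just_below[of \<rho> "2 * D", rotated 2]) auto
  have "2 ^ J * \<rho> < 2 ^ L * \<rho>" using L J D by linarith
  then have JL: "J \<le> L" using \<rho> by simp
  obtain X w where X: "finite X" "X \<subseteq> E" and w: "\<And>x. 0 \<le> w x" "sum w X = 1"
    and Frostman: "\<And>x l. \<lbrakk>x \<in> X; l \<le> L\<rbrakk> \<Longrightarrow> sum w (X \<inter> ball x (2 ^ l * \<rho>)) \<le> A * (2 ^ l * \<rho>) powr s"
    using discrete_Frostman[OF E \<rho>(1) _ _ \<epsilon> no, of L] L(1) \<rho> us \<rho>_alt unfolding A_def by auto
  define S where "S j x z = {V \<in> space \<gamma>. norm (orth_proj V (x - z)) \<le> 2 ^ j * \<rho>}" for j and x z :: "real ^ 'n"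
  have S[measurable]: "S j x z \<in> sets \<gamma>" for j x z unfolding S_def by measurable
  define G where "G V = (\<Sum>j\<le>J. (2 ^ j * \<rho>) powr - u *
      (\<Sum>x\<in>X. \<Sum>z\<in>X. w x * w z * indicator (S j x z) V))" for V
  have G0: "0 \<le> G V" for V
    unfolding G_def using w(1) by (intro sum_nonneg mult_nonneg_nonneg) auto
  define M where "M = real (8 * CARD('n) + 18) ^ CARD('n) * 2 ^ m"
  define M' where "M' = M * (A / (1 - 2 powr (s - m)) + 48 ^ m)"
  have M0: "0 \<le> M" by (simp add: M_def)
  have M'0: "0 \<le> M'" unfolding M'_def using M0 A us by (intro mult_nonneg_nonneg add_nonneg_nonneg divide_nonneg_nonneg) (use us powr_less_one[of 2 "s - real m"] in auto)
  have pair_energy: "(\<Sum>x\<in>X. \<Sum>z\<in>X. w x * w z * measure \<gamma> (S j x z)) \<le> M' * (2 ^ j * \<rho>) powr s"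
    if j: "j \<le> J" for j
  proof -
    let ?r = "2 ^ j * \<rho>"
    have "?r \<le> 2 ^ J * \<rho>" using j \<rho> by (intro mult_right_mono) auto
    then have r: "0 < ?r" "?r \<le> 2 * \<delta> ^ a"
      using \<rho>(1) order_trans[OF _ J(1)] by (simp_all add: D_def)
    have "(\<Sum>z\<in>X. w z * measure \<gamma> (S j x z)) \<le> M' * ?r powr s" if x: "x \<in> X" for x
    proof -
      have "(\<Sum>z\<in>X. w z * measure \<gamma> (S j x z))
          \<le> M * (A / (1 - 2 powr (s - m)) * ?r powr s + (?r / (2 ^ L * \<rho>)) ^ m)"
        unfolding S_def M_def using us j JL
        by (intro expected_neighbour_mass[OF \<gamma> X(1) x w \<rho>(1)] Frostman[OF x] A) auto
      also have "\<dots> \<le> M * (A / (1 - 2 powr (s - m)) * ?r powr s + 48 ^ m * ?r powr s)"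
        using M0 us a \<delta> L by (intro mult_left_mono add_left_mono scale_ratio_bound[OF r]) auto
      finally show ?thesis by (simp add: M'_def algebra_simps)
    qed
    then have "(\<Sum>x\<in>X. w x * (\<Sum>z\<in>X. w z * measure \<gamma> (S j x z))) \<le> (\<Sum>x\<in>X. w x * (M' * ?r powr s))"
      using w(1) by (intro sum_mono mult_left_mono)
    also have "\<dots> = M' * ?r powr s" using w(2) by (simp flip: sum_distrib_right)
    finally show ?thesis by (simp add: sum_distrib_left mult.assoc)
  qed
  have "integral\<^sup>L \<gamma> G = (\<Sum>j\<le>J. (2 ^ j * \<rho>) powr - u * (\<Sum>x\<in>X. \<Sum>z\<in>X. w x * w z * measure \<gamma> (S j x z)))"
    unfolding G_def by (simp add: Bochner_Integration.integral_sum emeasure_finite less_top[symmetric] integrable_real_mult_indicator)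
  also have "\<dots> \<le> (\<Sum>j\<le>J. (2 ^ j * \<rho>) powr - u * (M' * (2 ^ j * \<rho>) powr s))"
    using pair_energy by (intro sum_mono mult_left_mono) auto
  also have "\<dots> = M' * (\<Sum>j\<le>J. (2 ^ j * \<rho>) powr (s - u))"
    by (simp add: sum_distrib_left mult_ac flip: powr_add)
  also have "\<dots> \<le> M' * ((2 powr (s - u))\<^sup>2 / (2 powr (s - u) - 1) * D powr (s - u))"
    using M'0 us J by (intro mult_left_mono sum_dyadic_scales_le \<rho>) auto
  also have "\<dots> = energy_constant TYPE('n) m u s \<epsilon> * (\<delta> ^ a) powr (s - u)"
    by (simp add: energy_constant_def M'_def M_def A_def D_def)
  finally have int: "integral\<^sup>L \<gamma> G \<le> energy_constant TYPE('n) m u s \<epsilon> * (\<delta> ^ a) powr (s - u)" .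
  have intG: "integrable \<gamma> G"
    unfolding G_def by (intro Bochner_Integration.integrable_sum integrable_mult_right integrable_real_indicator S) (simp add: less_top[symmetric])
  show ?thesis
  proof (intro exI[of _ G] conjI allI ballI impI)
    show "G \<in> borel_measurable \<gamma>" using intG by simp
    show "(\<integral>\<^sup>+V. ennreal (G V) \<partial>\<gamma>) \<le> ennreal (energy_constant TYPE('n) m u s \<epsilon> * (\<delta> ^ a) powr (s - u))"
      using nn_integral_eq_integral[OF intG] G0 int by (simp add: ennreal_leI)
    fix V \<eta> assume V: "V \<in> space \<gamma>" and \<eta>: "0 \<le> \<eta>" and hc: "has_cover \<theta> (\<delta> ^ a) u \<eta> (orth_proj V ` E)"
    have "subspace V" using V space_grassmannian_haar[OF \<gamma>] by (simp add: grassmannian_def)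
    then have "indicator (S j x z) V = (of_bool (dist (orth_proj V x) (orth_proj V z) \<le> 2 ^ j * \<rho>) :: real)" for j x z
      using V by (simp add: S_def indicator_def dist_norm linear_diff linear_orth_proj)
    then show "1 \<le> 2 powr u * G V * \<eta>"
      using cover_sum_times_energy_ge_1[OF X w us(1) \<rho>(1) _ D(1) _ hc[folded D_def] \<eta>, of J] J(2)
      by (simp add: G_def \<rho>_def)
  qed (use G0 in auto)
qed

text \<open>
  The mean energies at the scales \<open>\<delta> n\<close> are summable. Hence for almost every \<open>V\<close> the energies themselves
  are summable, in particular bounded in \<open>n\<close>, and covers of bounded energy cannot be cheap.
\<close>

lemma AE_no_projected_covers:
  fixes E :: "(real ^ 'n) set" and \<delta> :: "nat \<Rightarrow> real"
  assumes \<gamma>: "grassmannian_haar m \<gamma>" and E: "compact E"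
    and us: "0 \<le> u" "u < s" "s < real m" and \<theta>: "0 < \<theta>" "\<theta> \<le> 1" and \<epsilon>: "0 < \<epsilon>"
    and a: "2 \<le> a" "real m \<le> real a * (real m - s)"
    and \<delta>: "\<And>n. 0 < \<delta> n" "\<And>n. \<delta> n \<le> (1 / 2) ^ n / 48"
    and no: "\<And>n. \<not> has_cover (\<theta> / a) (\<delta> n) s \<epsilon> E"
  shows "AE V in \<gamma>. \<exists>c>0. \<forall>n. \<not> has_cover \<theta> (\<delta> n ^ a) u c (orth_proj V ` E)"
proof -
  have \<delta>48: "\<delta> n \<le> 1 / 48" for n
  proof -
    have "(1 / 2 :: real) ^ n \<le> 1" by (rule power_le_one) auto
    then show ?thesis using \<delta>(2)[of n] by linarith
  qed
  define C where "C = energy_constant TYPE('n) m u s \<epsilon>"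
  have C0: "0 \<le> C"
  proof -
    have "0 \<le> 1 - 2 powr (s - m)" using us powr_less_one[of 2 "s - real m"] by simp
    moreover have "0 \<le> 2 powr (s - u) - 1" using us by (simp add: ge_one_powr_ge_zero)
    ultimately show ?thesis unfolding C_def energy_constant_def using \<epsilon>
      by (intro mult_nonneg_nonneg add_nonneg_nonneg divide_nonneg_nonneg) auto
  qed
  have "\<forall>n. \<exists>G. G \<in> borel_measurable \<gamma> \<and> (\<forall>V. 0 \<le> G V) \<and>
    (\<integral>\<^sup>+V. ennreal (G V) \<partial>\<gamma>) \<le> ennreal (C * (\<delta> n ^ a) powr (s - u)) \<and>
    (\<forall>V\<in>space \<gamma>. \<forall>\<eta>\<ge>0. has_cover \<theta> (\<delta> n ^ a) u \<eta> (orth_proj V ` E) \<longrightarrow> 1 \<le> 2 powr u * G V * \<eta>)"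
    unfolding C_def using exists_energy_function[OF \<gamma> E us \<theta> \<epsilon> a \<delta>(1) \<delta>48 no] by blast
  then obtain G where G: "\<And>n. G n \<in> borel_measurable \<gamma>" "\<And>n V. 0 \<le> G n V"
    "\<And>n. (\<integral>\<^sup>+V. ennreal (G n V) \<partial>\<gamma>) \<le> ennreal (C * (\<delta> n ^ a) powr (s - u))"
    "\<And>n V \<eta>. \<lbrakk>V \<in> space \<gamma>; 0 \<le> \<eta>; has_cover \<theta> (\<delta> n ^ a) u \<eta> (orth_proj V ` E)\<rbrakk> \<Longrightarrow> 1 \<le> 2 powr u * G n V * \<eta>"
    by metis
  note [measurable] = G(1)
  define q where "q = (1 / 2) powr (s - u)"
  have "q = 1 / 2 powr (s - u)" by (simp add: q_def powr_divide)
  then have q: "0 < q" "q < 1" using us by auto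
  have bound: "C * (\<delta> n ^ a) powr (s - u) \<le> C * q ^ n" for n
  proof -
    have "\<delta> n ^ a \<le> \<delta> n ^ 1" using \<delta>(1)[of n] \<delta>48[of n] a by (intro power_decreasing) auto
    also have "\<dots> \<le> (1 / 2) ^ n / 48" using \<delta>(2)[of n] by simp
    also have "\<dots> \<le> (1 / 2) ^ n" by simp
    finally have "(\<delta> n ^ a) powr (s - u) \<le> ((1 / 2) ^ n) powr (s - u)"
      using us \<delta>(1)[of n] by (intro powr_mono2) auto
    also have "\<dots> = q ^ n"
      by (simp add: q_def powr_powr mult.commute flip: powr_realpow)
    finally show ?thesis using C0 by (intro mult_left_mono)
  qed
  have "(\<integral>\<^sup>+V. (\<Sum>n. ennreal (G n V)) \<partial>\<gamma>) = (\<Sum>n. \<integral>\<^sup>+V. ennreal (G n V) \<partial>\<gamma>)"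
    by (intro nn_integral_suminf) measurable
  also have "\<dots> \<le> (\<Sum>n. ennreal (C * q ^ n))"
    using G(3) bound by (intro suminf_le summableI) (meson ennreal_leI order_trans)
  also have "\<dots> < \<infinity>"
  proof -
    have "summable (\<lambda>n. C * q ^ n)" using q by (intro summable_mult summable_geometric) auto
    then have "(\<Sum>n. ennreal (C * q ^ n)) \<noteq> top"
      using C0 q by (intro ennreal_suminf_neq_top) auto
    then show ?thesis by (simp add: less_top)
  qed
  finally have "AE V in \<gamma>. (\<Sum>n. ennreal (G n V)) \<noteq> \<infinity>"
    by (intro nn_integral_PInf_AE) auto
  then show ?thesis
  proof (rule AE_mp, intro AE_I2 impI)
    fix V assume V: "V \<in> space \<gamma>" and fin: "(\<Sum>n. ennreal (G n V)) \<noteq> \<infinity>"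
    define H where "H = enn2real (\<Sum>n. ennreal (G n V)) + 1"
    have H: "0 < H" by (simp add: H_def add_nonneg_pos)
    have "G n V \<le> H" for n
    proof -
      have "ennreal (G n V) \<le> (\<Sum>n. ennreal (G n V))"
        using sum_le_suminf[of "\<lambda>n. ennreal (G n V)" "{n}"] by simp
      also have "\<dots> = ennreal (enn2real (\<Sum>n. ennreal (G n V)))"
        using fin by (simp add: less_top)
      finally have "G n V \<le> enn2real (\<Sum>n. ennreal (G n V))" by simp
      then show ?thesis by (simp add: H_def)
    qed
    define c where "c = 1 / (2 * (2 powr u * H))"
    have c: "0 < c" using H by (simp add: c_def)
    have "\<not> has_cover \<theta> (\<delta> n ^ a) u c (orth_proj V ` E)" for n
    proof
      assume "has_cover \<theta> (\<delta> n ^ a) u c (orth_proj V ` E)"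
      then have "1 \<le> 2 powr u * G n V * c" using G(4) V c by simp
      also have "\<dots> \<le> 2 powr u * H * c"
        using \<open>G n V \<le> H\<close> c by (intro mult_right_mono mult_left_mono) auto
      also have "\<dots> = 1 / 2" using H by (simp add: c_def)
      finally show False by simp
    qed
    then show "\<exists>c>0. \<forall>n. \<not> has_cover \<theta> (\<delta> n ^ a) u c (orth_proj V ` E)" using c by blast
  qed
qed

lemma exists_large_exponent:
  fixes s :: real
  assumes "s < real m"
  obtains a :: nat where "2 \<le> a" "real m \<le> real a * (real m - s)"
proof -
  obtain k :: nat where k: "real m / (real m - s) \<le> real k" using real_arch_simple by blast
  have "real m \<le> real k * (real m - s)" using k assms by (simp add: field_simps)
  also have "\<dots> \<le> real (k + 2) * (real m - s)" using assms by (intro mult_right_mono) auto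
  finally show thesis using that[of "k + 2"] by simp
qed

lemma compact_imp_bounded_projection:
  fixes E :: "'a::euclidean_space set"
  assumes "compact E" "subspace V"
  shows "bounded (orth_proj V ` E)"
  using assms by (intro bounded_linear_image compact_imp_bounded
      linear_conv_bounded_linear[THEN iffD1] linear_orth_proj)

text \<open>
  Here covers must be excluded at all small scales, whereas the almost sure statement concerns a
  sequence. A cover at a scale between \<open>\<delta> (k + 1) ^ a\<close> and \<open>\<delta> k ^ a\<close> with parameter \<open>\<theta>\<close> is also one at
  scale \<open>\<delta> k ^ a\<close> with parameter \<open>\<theta> / 2\<close>, so the sequence \<open>\<delta> k = t / 2 ^ k\<close> suffices.
\<close>

lemma AE_lower_intermediate_dim_projection_ge:
  fixes E :: "(real ^ 'n) set"
  assumes \<gamma>: "grassmannian_haar m \<gamma>" and E: "compact E"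
    and us: "0 \<le> u" "u < s" "s < real m" and sE: "s < lower.quasi_Hausdorff_dim E"
    and \<theta>: "0 < \<theta>" "\<theta> \<le> 1"
  shows "AE V in \<gamma>. u \<le> lower.intermediate_dim \<theta> (orth_proj V ` E)"
proof -
  obtain a :: nat where a: "2 \<le> a" "real m \<le> real a * (real m - s)"
    using exists_large_exponent us by blast
  define \<theta>' where "\<theta>' = \<theta> / 2 / a"
  have \<theta>': "0 < \<theta>'" "\<theta>' \<le> 1" using \<theta> a by (auto simp: \<theta>'_def field_simps)
  have "s < lower.intermediate_dim \<theta>' E"
    using sE lower.quasi_Hausdorff_dim_le_intermediate_dim[OF compact_imp_bounded[OF E] \<theta>'] by linarith
  then obtain \<epsilon> where \<epsilon>: "0 < \<epsilon>" "\<not> (\<exists>\<^sub>F \<delta> in at_right 0. has_cover \<theta>' \<delta> s \<epsilon> E)"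
    using lower.no_cover_below_intermediate_dim[of s \<theta>' E] us by auto
  then obtain \<delta>0 where \<delta>0: "0 < \<delta>0" "\<And>\<delta>. \<lbrakk>0 < \<delta>; \<delta> \<le> \<delta>0\<rbrakk> \<Longrightarrow> \<not> has_cover \<theta>' \<delta> s \<epsilon> E"
    unfolding frequently_at_right_0_iff by auto
  define t where "t = min \<delta>0 (1 / 48)"
  have t: "0 < t" "t \<le> \<delta>0" "t \<le> 1 / 48" using \<delta>0 by (auto simp: t_def)
  define \<delta> where "\<delta> n = t / 2 ^ n" for n
  have \<delta>: "0 < \<delta> n" "\<delta> n \<le> t" "\<delta> n \<le> (1 / 2) ^ n / 48" for n
    using t by (auto simp: \<delta>_def field_simps intro: order_trans)
  have "AE V in \<gamma>. \<exists>c>0. \<forall>n. \<not> has_cover (\<theta> / 2) (\<delta> n ^ a) u c (orth_proj V ` E)"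
  proof (rule AE_no_projected_covers[OF \<gamma> E us _ _ \<epsilon>(1) a])
    show "\<not> has_cover (\<theta> / 2 / a) (\<delta> n) s \<epsilon> E" for n
      using \<delta>0(2)[of "\<delta> n"] \<delta>[of n] t unfolding \<theta>'_def by linarith
  qed (use \<theta> \<delta> in auto)
  then show ?thesis
  proof (rule AE_mp, intro AE_I2 impI)
    fix V assume V: "V \<in> space \<gamma>"
      and "\<exists>c>0. \<forall>n. \<not> has_cover (\<theta> / 2) (\<delta> n ^ a) u c (orth_proj V ` E)"
    then obtain c where c: "0 < c" "\<And>n. \<not> has_cover (\<theta> / 2) (\<delta> n ^ a) u c (orth_proj V ` E)"
      by blast
    have sub: "subspace V" using V space_grassmannian_haar[OF \<gamma>] by (simp add: grassmannian_def)
    have "\<not> has_cover \<theta> D u c (orth_proj V ` E)" if D: "0 < D" "D \<le> t ^ a" for D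
    proof
      assume hc: "has_cover \<theta> D u c (orth_proj V ` E)"
      define y where "y = root a D"
      have y: "0 < y" "y ^ a = D" using a D by (auto simp: y_def)
      have "y \<le> t"
      proof (rule ccontr)
        assume "\<not> y \<le> t"
        then have "t ^ a < y ^ a" using t a by (intro power_strict_mono) auto
        then show False using D y by simp
      qed
      then obtain k where k: "2 ^ k * y \<le> t" "t < 2 * (2 ^ k * y)"
        using dyadic_multiple_just_below y(1) by metis
      have yk: "y \<le> \<delta> k" "\<delta> k / 2 \<le> y" using k by (auto simp: \<delta>_def field_simps)
      have "has_cover (\<theta> / 2) (\<delta> k ^ a) u c (orth_proj V ` E)"
      proof (rule has_cover_mono_range[OF hc])
        show "D \<le> \<delta> k ^ a" using yk y by (metis less_imp_le power_mono)
        have "\<delta> k * \<delta> k \<le> \<delta> k * (1 / 2)"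
          using \<delta>[of k] t by (intro mult_left_mono) auto
        also have "\<dots> \<le> y" using yk by simp
        finally have "(\<delta> k * \<delta> k) ^ a \<le> D" using y \<delta>[of k] by (metis less_imp_le mult_pos_pos power_mono)
        then have "((\<delta> k ^ a) powr 2) powr (1 / \<theta>) \<le> D powr (1 / \<theta>)"
          using \<delta>[of k] \<theta> by (intro powr_mono2) (auto simp: power_mult_distrib power2_eq_square)
        then show "(\<delta> k ^ a) powr (1 / (\<theta> / 2)) \<le> D powr (1 / \<theta>)"
          by (simp add: powr_powr)
      qed
      then show False using c by blast
    qed
    then have "\<not> (\<exists>\<^sub>F \<delta> in at_right 0. has_cover \<theta> \<delta> u c (orth_proj V ` E))"
      unfolding frequently_at_right_0_iff using t by (auto intro!: exI[of _ "t ^ a"])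
    then show "u \<le> lower.intermediate_dim \<theta> (orth_proj V ` E)"
      using compact_imp_bounded_projection[OF E sub] \<theta> c by (intro lower.intermediate_dim_ge)
  qed
qed

text \<open>
  For the upper dimension it is enough to exclude covers at some arbitrarily small scales, and these
  can be chosen to decay geometrically.
\<close>

lemma AE_upper_intermediate_dim_projection_ge:
  fixes E :: "(real ^ 'n) set"
  assumes \<gamma>: "grassmannian_haar m \<gamma>" and E: "compact E"
    and us: "0 \<le> u" "u < s" "s < real m" and sE: "s < upper.quasi_Hausdorff_dim E"
    and \<theta>: "0 < \<theta>" "\<theta> \<le> 1"
  shows "AE V in \<gamma>. u \<le> upper.intermediate_dim \<theta> (orth_proj V ` E)"
proof -
  obtain a :: nat where a: "2 \<le> a" "real m \<le> real a * (real m - s)"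
    using exists_large_exponent us by blast
  define \<theta>' where "\<theta>' = \<theta> / a"
  have \<theta>': "0 < \<theta>'" "\<theta>' \<le> 1" using \<theta> a by (auto simp: \<theta>'_def field_simps)
  have "s < upper.intermediate_dim \<theta>' E"
    using sE upper.quasi_Hausdorff_dim_le_intermediate_dim[OF compact_imp_bounded[OF E] \<theta>'] by linarith
  then obtain \<epsilon> where \<epsilon>: "0 < \<epsilon>" "\<not> (\<forall>\<^sub>F \<delta> in at_right 0. has_cover \<theta>' \<delta> s \<epsilon> E)"
    using upper.no_cover_below_intermediate_dim[of s \<theta>' E] us by auto
  have "\<forall>n. \<exists>\<delta>. 0 < \<delta> \<and> \<delta> \<le> (1 / 2) ^ n / 48 \<and> \<not> has_cover \<theta>' \<delta> s \<epsilon> E"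
  proof
    fix n
    have "(0::real) < (1 / 2) ^ n / 48" by simp
    then show "\<exists>\<delta>. 0 < \<delta> \<and> \<delta> \<le> (1 / 2) ^ n / 48 \<and> \<not> has_cover \<theta>' \<delta> s \<epsilon> E"
      using \<epsilon>(2) unfolding eventually_at_right_0_iff by blast
  qed
  then obtain \<delta> where \<delta>: "\<And>n. 0 < \<delta> n" "\<And>n. \<delta> n \<le> (1 / 2) ^ n / 48"
      "\<And>n. \<not> has_cover \<theta>' (\<delta> n) s \<epsilon> E"
    by metis
  have "AE V in \<gamma>. \<exists>c>0. \<forall>n. \<not> has_cover \<theta> (\<delta> n ^ a) u c (orth_proj V ` E)"
    using \<delta>(3) unfolding \<theta>'_def by (intro AE_no_projected_covers[OF \<gamma> E us \<theta> \<epsilon>(1) a \<delta>(1,2)]) auto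
  then show ?thesis
  proof (rule AE_mp, intro AE_I2 impI)
    fix V assume V: "V \<in> space \<gamma>"
      and "\<exists>c>0. \<forall>n. \<not> has_cover \<theta> (\<delta> n ^ a) u c (orth_proj V ` E)"
    then obtain c where c: "0 < c" "\<And>n. \<not> has_cover \<theta> (\<delta> n ^ a) u c (orth_proj V ` E)"
      by blast
    have sub: "subspace V" using V space_grassmannian_haar[OF \<gamma>] by (simp add: grassmannian_def)
    have "\<not> (\<forall>\<^sub>F \<delta> in at_right 0. has_cover \<theta> \<delta> u c (orth_proj V ` E))"
    proof
      assume "\<forall>\<^sub>F \<delta> in at_right 0. has_cover \<theta> \<delta> u c (orth_proj V ` E)"
      then obtain \<delta>0 where \<delta>0: "0 < \<delta>0" "\<And>\<delta>. \<lbrakk>0 < \<delta>; \<delta> \<le> \<delta>0\<rbrakk> \<Longrightarrow> has_cover \<theta> \<delta> u c (orth_proj V ` E)"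
        unfolding eventually_at_right_0_iff by auto
      obtain n where n: "(1 / 2) ^ n < \<delta>0" using real_arch_pow_inv[OF \<delta>0(1), of "1/2"] by auto
      have "\<delta> n \<le> (1 / 2) ^ n" using \<delta>(2)[of n] by (rule order_trans) simp
      moreover have "\<delta> n \<le> 1" using calculation power_le_one[of "1/2::real" n] by simp
      then have "\<delta> n ^ a \<le> \<delta> n ^ 1" using \<delta>(1)[of n] a by (intro power_decreasing) auto
      ultimately have "\<delta> n ^ a \<le> \<delta>0" using n by simp
      then show False using \<delta>0(2)[of "\<delta> n ^ a"] \<delta>(1)[of n] c(2)[of n] by simp
    qed
    then show "u \<le> upper.intermediate_dim \<theta> (orth_proj V ` E)"
      using compact_imp_bounded_projection[OF E sub] \<theta> c by (intro upper.intermediate_dim_ge)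
  qed
qed

text \<open>
  The exceptional null set in the hypothesis may depend on \<open>u\<close>, \<open>s\<close> and \<open>\<theta>\<close>. By monotonicity in \<open>\<theta>\<close> it
  suffices to use the hypothesis along sequences with \<open>\<theta>\<close> tending to \<open>0\<close> and \<open>u\<close>, \<open>s\<close> increasing to the
  claimed value \<open>T\<close>.
\<close>

lemma (in small_scales) quasi_Hausdorff_dim_projection:
  fixes E :: "(real ^ 'n) set"
  assumes \<gamma>: "grassmannian_haar m \<gamma>" and E: "compact E"
    and ge: "\<And>u s \<theta>. \<lbrakk>0 \<le> u; u < s; s < real m; s < quasi_Hausdorff_dim E; 0 < \<theta>; \<theta> \<le> 1\<rbrakk>
      \<Longrightarrow> AE V in \<gamma>. u \<le> intermediate_dim \<theta> (orth_proj V ` E)"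
  shows "AE V in \<gamma>. quasi_Hausdorff_dim (orth_proj V ` E) = min (real m) (quasi_Hausdorff_dim E)"
proof -
  define T where "T = min (real m) (quasi_Hausdorff_dim E)"
  have bE: "bounded E" using E by (rule compact_imp_bounded)
  have sub: "subspace V" "dim V = m" if "V \<in> space \<gamma>" for V
    using that space_grassmannian_haar[OF \<gamma>] by (auto simp: grassmannian_def)
  have bP: "bounded (orth_proj V ` E)" if "V \<in> space \<gamma>" for V
    using compact_imp_bounded_projection[OF E] sub that by blast
  have "AE V in \<gamma>. T - 2 / (real k + 1) \<le> intermediate_dim (1 / (real k + 1)) (orth_proj V ` E)" for k
  proof (cases "0 \<le> T - 2 / (real k + 1)")
    case True
    define e where "e = 1 / (real k + 1)"
    have e: "0 < e" "e \<le> 1" and e2: "2 / (real k + 1) = 2 * e" by (auto simp: e_def)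
    have T: "T \<le> real m" "T \<le> quasi_Hausdorff_dim E" by (auto simp: T_def)
    \<comment> \<open>Both \<open>\<theta> = e\<close> and the gaps in \<open>T - 2 * e < T - e < T\<close> are governed by the same index.\<close>
    have "AE V in \<gamma>. T - 2 * e \<le> intermediate_dim e (orth_proj V ` E)"
      by (rule ge[of _ "T - e"]) (use True e e2 T in linarith)+
    then show ?thesis by (simp only: e2 e_def[symmetric])
  next
    case False
    show ?thesis
    proof (rule AE_I2)
      fix V assume "V \<in> space \<gamma>"
      then have "0 \<le> intermediate_dim (1 / (real k + 1)) (orth_proj V ` E)"
        by (intro intermediate_dim_nonneg bP) (auto simp: field_simps)
      then show "T - 2 / (real k + 1) \<le> intermediate_dim (1 / (real k + 1)) (orth_proj V ` E)"
        using False by linarith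
    qed
  qed
  then have "AE V in \<gamma>. \<forall>k. T - 2 / (real k + 1) \<le> intermediate_dim (1 / (real k + 1)) (orth_proj V ` E)"
    by (simp add: AE_all_countable)
  then show ?thesis
  proof (rule AE_mp, intro AE_I2 impI)
    fix V assume V: "V \<in> space \<gamma>"
      and low: "\<forall>k. T - 2 / (real k + 1) \<le> intermediate_dim (1 / (real k + 1)) (orth_proj V ` E)"
    have "orth_proj V ` E \<subseteq> V" using orth_proj_in[OF sub(1)[OF V]] by blast
    then have "quasi_Hausdorff_dim (orth_proj V ` E) \<le> real m"
      using quasi_Hausdorff_dim_le_intermediate_dim[OF bP[OF V], of 1]
        intermediate_dim_le_dim[OF sub(1)[OF V] _ bP[OF V], of 1] sub(2)[OF V] by simp
    moreover have "quasi_Hausdorff_dim (orth_proj V ` E) \<le> quasi_Hausdorff_dim E"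
    proof (rule quasi_Hausdorff_dim_ge[OF bE])
      fix \<theta> :: real assume \<theta>: "0 < \<theta>" "\<theta> \<le> 1"
      have "quasi_Hausdorff_dim (orth_proj V ` E) \<le> intermediate_dim \<theta> (orth_proj V ` E)"
        by (rule quasi_Hausdorff_dim_le_intermediate_dim[OF bP[OF V] \<theta>])
      also have "\<dots> \<le> intermediate_dim \<theta> E"
        using dist_orth_proj_le[OF sub(1)[OF V]] by (rule intermediate_dim_nonexpansive_image[OF bE \<theta>])
      finally show "quasi_Hausdorff_dim (orth_proj V ` E) \<le> intermediate_dim \<theta> E" .
    qed
    moreover have "T \<le> quasi_Hausdorff_dim (orth_proj V ` E)"
    proof (rule quasi_Hausdorff_dim_ge[OF bP[OF V]])
      fix \<theta> :: real assume \<theta>: "0 < \<theta>" "\<theta> \<le> 1"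
      show "T \<le> intermediate_dim \<theta> (orth_proj V ` E)"
      proof (rule field_le_epsilon)
        fix e :: real assume e: "0 < e"
        obtain k :: nat where k: "max (1 / \<theta>) (2 / e) \<le> real k" using real_arch_simple by blast
        have "1 / (real k + 1) \<le> \<theta>" "2 / (real k + 1) \<le> e"
          using k \<theta> e by (auto simp: field_simps)
        then have "intermediate_dim (1 / (real k + 1)) (orth_proj V ` E) \<le> intermediate_dim \<theta> (orth_proj V ` E)"
          using \<theta> by (intro intermediate_dim_mono bP[OF V]) auto
        then show "T \<le> intermediate_dim \<theta> (orth_proj V ` E) + e"
          using low[rule_format, of k] \<open>2 / (real k + 1) \<le> e\<close> by linarith
      qed
    qed
    ultimately show "quasi_Hausdorff_dim (orth_proj V ` E) = min (real m) (quasi_Hausdorff_dim E)"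
      by (simp add: T_def)
  qed
qed

theorem theorem3p1:
  fixes E :: "(real ^ 'n) set" and m :: nat and \<gamma> :: "(real ^ 'n) set measure"
  assumes "compact E" and "E \<noteq> {}"
    and "m \<le> CARD('n)"
    and "grassmannian_haar m \<gamma>"
  shows "(AE V in \<gamma>. lower_quasi_Hausdorff_dim (orth_proj V ` E)
            = min (real m) (lower_quasi_Hausdorff_dim E)) \<and>
         (AE V in \<gamma>. upper_quasi_Hausdorff_dim (orth_proj V ` E)
            = min (real m) (upper_quasi_Hausdorff_dim E))"
  unfolding lower_quasi_Hausdorff_dim_eq upper_quasi_Hausdorff_dim_eq
  using assms(1,4)
  by (intro conjI lower.quasi_Hausdorff_dim_projection upper.quasi_Hausdorff_dim_projection
      AE_lower_intermediate_dim_projection_ge AE_upper_intermediate_dim_projection_ge)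

end
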